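(* Let $\Gamma$ be an inner ultrahomogeneous group of infinite exponent. Then, in $\operatorname{Th}(\Gamma)$ (language of groups): (1) the formula $xy=yx$ has the independence property (in particular the order property); (2) for each $n$, the formula $\varphi(x_1,\dots,x_n;y_1,y_2)$ expressing $y_1^{x_1x_2\cdots x_n}\in C(y_2)$ has the $n$-independence property; (3) the formula $C(x)\subseteq C(y)$ has the strict order property; (4) the formula $x\in C(y_2)\setminus C(y_1)$ (with object variable $x$ and parameter variables $y_1,y_2$) has the tree property of the second kind.
   Context: Conjugation is written $g^h=h^{-1}gh$. A finite partial automorphism of a group $G$ is an isomorphism between two finitely generated subgroups of $G$. A group $\Gamma$ is inner ultrahomogeneous if for every finite partial automorphism $p$ of $\Gamma$ there is some $g\in\Gamma$ such that $a^g=p(a)$ for all $a\in\operatorname{dom}p$. $C(y)$ denotes the centraliser of $y$; "$u\in C(y)$" is the formula $uy=yu$, and "$C(x)\subseteq C(y)$" is $\forall z(zx=xz\to zy=yz)$. Infinite exponent means not of finite exponent. *)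

theory Defs
  imports "HOL-Algebra.Generated_Groups"
begin

section \<open>Inner ultrahomogeneous groups\<close>

definition fg_subgroup :: "'a set \<Rightarrow> ('a, 'b) monoid_scheme \<Rightarrow> bool" where
  "fg_subgroup H G \<longleftrightarrow> subgroup H G \<and> (\<exists>A. finite A \<and> A \<subseteq> carrier G \<and> H = generate G A)"

text \<open>The maps \<open>p\<close> below are total functions; only their restriction to \<open>H\<close> is relevant.\<close>

definition finite_partial_aut :: "('a, 'b) monoid_scheme \<Rightarrow> 'a set \<Rightarrow> 'a set \<Rightarrow> ('a \<Rightarrow> 'a) \<Rightarrow> bool" where
  "finite_partial_aut G H K p \<longleftrightarrow> fg_subgroup H G \<and> fg_subgroup K G \<and>
     p \<in> iso (G\<lparr>carrier := H\<rparr>) (G\<lparr>carrier := K\<rparr>)"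

definition inner_ultrahomogeneous :: "('a, 'b) monoid_scheme \<Rightarrow> bool" where
  "inner_ultrahomogeneous G \<longleftrightarrow>
     (\<forall>H K p. finite_partial_aut G H K p \<longrightarrow>
        (\<exists>g\<in>carrier G. \<forall>a\<in>H. inv\<^bsub>G\<^esub> g \<otimes>\<^bsub>G\<^esub> a \<otimes>\<^bsub>G\<^esub> g = p a))"

definition infinite_exponent :: "('a, 'b) monoid_scheme \<Rightarrow> bool" where
  "infinite_exponent G \<longleftrightarrow> \<not> (\<exists>n::nat. n > 0 \<and> (\<forall>g\<in>carrier G. g [^]\<^bsub>G\<^esub> n = \<one>\<^bsub>G\<^esub>))"


section \<open>First-order logic in the language of groups\<close>

datatype tm = Var nat | One | Mul tm tm | Inv tm

datatype fm = Eq tm tm | Neg fm | Conj fm fm | All nat fm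

definition Imp :: "fm \<Rightarrow> fm \<Rightarrow> fm" where
  "Imp p q = Neg (Conj p (Neg q))"

primrec fv_tm :: "tm \<Rightarrow> nat set" where
  "fv_tm (Var v) = {v}"
| "fv_tm One = {}"
| "fv_tm (Mul t u) = fv_tm t \<union> fv_tm u"
| "fv_tm (Inv t) = fv_tm t"

primrec fv :: "fm \<Rightarrow> nat set" where
  "fv (Eq t u) = fv_tm t \<union> fv_tm u"
| "fv (Neg p) = fv p"
| "fv (Conj p q) = fv p \<union> fv q"
| "fv (All v p) = fv p - {v}"

primrec val :: "('a, 'b) monoid_scheme \<Rightarrow> (nat \<Rightarrow> 'a) \<Rightarrow> tm \<Rightarrow> 'a" where
  "val M s (Var v) = s v"
| "val M s One = \<one>\<^bsub>M\<^esub>"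
| "val M s (Mul t u) = val M s t \<otimes>\<^bsub>M\<^esub> val M s u"
| "val M s (Inv t) = inv\<^bsub>M\<^esub> (val M s t)"

primrec sat :: "('a, 'b) monoid_scheme \<Rightarrow> (nat \<Rightarrow> 'a) \<Rightarrow> fm \<Rightarrow> bool" where
  "sat M s (Eq t u) \<longleftrightarrow> val M s t = val M s u"
| "sat M s (Neg p) \<longleftrightarrow> \<not> sat M s p"
| "sat M s (Conj p q) \<longleftrightarrow> sat M s p \<and> sat M s q"
| "sat M s (All v p) \<longleftrightarrow> (\<forall>a\<in>carrier M. sat M (s(v := a)) p)"

definition holds :: "('a, 'b) monoid_scheme \<Rightarrow> fm \<Rightarrow> bool" where
  "holds M p \<longleftrightarrow> (\<forall>s. (\<forall>v. s v \<in> carrier M) \<longrightarrow> sat M s p)"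

definition Th :: "('a, 'b) monoid_scheme \<Rightarrow> fm set" where
  "Th M = {p. fv p = {} \<and> holds M p}"

text \<open>Only groups are considered as structures. For theories \<open>Th \<Gamma>\<close> of a group \<open>\<Gamma>\<close>, which
  contain the group axioms, this excludes no model.\<close>

definition is_model :: "('a, 'b) monoid_scheme \<Rightarrow> fm set \<Rightarrow> bool" where
  "is_model M T \<longleftrightarrow> group M \<and> (\<forall>p\<in>T. holds M p)"

text \<open>A partitioned formula \<open>\<phi>(x;y)\<close> is given by a formula and the lists \<open>xs\<close>, \<open>ys\<close> of variables
  forming the tuples \<open>x\<close> and \<open>y\<close>; \<open>xs @ ys\<close> should be distinct and contain the free variables
  of \<open>\<phi>\<close>.\<close>

definition tuples :: "('a, 'b) monoid_scheme \<Rightarrow> nat list \<Rightarrow> 'a list set" where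
  "tuples M vs = {as. length as = length vs \<and> set as \<subseteq> carrier M}"

definition sat_at :: "('a, 'b) monoid_scheme \<Rightarrow> fm \<Rightarrow> nat list \<Rightarrow> 'a list \<Rightarrow> bool" where
  "sat_at M p vs as \<longleftrightarrow>
     sat M (\<lambda>v. case map_of (zip vs as) v of Some a \<Rightarrow> a | None \<Rightarrow> \<one>\<^bsub>M\<^esub>) p"


section \<open>Dividing lines, witnessed in a structure\<close>

definition IP_in :: "('a, 'b) monoid_scheme \<Rightarrow> fm \<Rightarrow> nat list \<Rightarrow> nat list \<Rightarrow> bool" where
  "IP_in M p xs ys \<longleftrightarrow>
     (\<exists>(a :: nat \<Rightarrow> 'a list) (b :: nat set \<Rightarrow> 'a list).
        (\<forall>i. a i \<in> tuples M xs) \<and> (\<forall>S. b S \<in> tuples M ys) \<and>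
        (\<forall>i S. sat_at M p (xs @ ys) (a i @ b S) \<longleftrightarrow> i \<in> S))"

definition OP_in :: "('a, 'b) monoid_scheme \<Rightarrow> fm \<Rightarrow> nat list \<Rightarrow> nat list \<Rightarrow> bool" where
  "OP_in M p xs ys \<longleftrightarrow>
     (\<exists>(a :: nat \<Rightarrow> 'a list) (b :: nat \<Rightarrow> 'a list).
        (\<forall>i. a i \<in> tuples M xs) \<and> (\<forall>j. b j \<in> tuples M ys) \<and>
        (\<forall>i j. sat_at M p (xs @ ys) (a i @ b j) \<longleftrightarrow> i < j))"

text \<open>For a formula \<open>\<phi>(x\<^sub>1, \<dots>, x\<^sub>n; y)\<close> with \<open>x\<^sub>j\<close> the tuple \<open>xss ! (j - 1)\<close>, the \<open>n\<close>-independence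
  property: there are \<open>n\<close> sequences \<open>a j\<close> and, for each set \<open>S\<close> of \<open>n\<close>-tuples of indices (lists
  of length \<open>n\<close>), a tuple \<open>b S\<close> such that
  \<open>\<phi>(a 0 i\<^sub>1, \<dots>, a (n - 1) i\<^sub>n; b S)\<close> holds iff \<open>(i\<^sub>1, \<dots>, i\<^sub>n) \<in> S\<close>.\<close>

definition nIP_in :: "('a, 'b) monoid_scheme \<Rightarrow> fm \<Rightarrow> nat list list \<Rightarrow> nat list \<Rightarrow> bool" where
  "nIP_in M p xss ys \<longleftrightarrow>
     (let n = length xss in
      \<exists>(a :: nat \<Rightarrow> nat \<Rightarrow> 'a list) (b :: nat list set \<Rightarrow> 'a list).
        (\<forall>j<n. \<forall>i. a j i \<in> tuples M (xss ! j)) \<and>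
        (\<forall>S \<subseteq> {l. length l = n}. b S \<in> tuples M ys) \<and>
        (\<forall>S \<subseteq> {l. length l = n}. \<forall>l. length l = n \<longrightarrow>
           (sat_at M p (concat xss @ ys) (concat (map (\<lambda>j. a j (l ! j)) [0..<n]) @ b S)
              \<longleftrightarrow> l \<in> S)))"

definition solutions :: "('a, 'b) monoid_scheme \<Rightarrow> fm \<Rightarrow> nat list \<Rightarrow> nat list \<Rightarrow> 'a list \<Rightarrow> 'a list set" where
  "solutions M p xs ys b = {a \<in> tuples M xs. sat_at M p (xs @ ys) (a @ b)}"

definition SOP_in :: "('a, 'b) monoid_scheme \<Rightarrow> fm \<Rightarrow> nat list \<Rightarrow> nat list \<Rightarrow> bool" where
  "SOP_in M p xs ys \<longleftrightarrow>
     (\<exists>b :: nat \<Rightarrow> 'a list. (\<forall>i. b i \<in> tuples M ys) \<and>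
        (\<forall>i j. i < j \<longrightarrow> solutions M p xs ys (b i) \<subset> solutions M p xs ys (b j)))"

text \<open>Tree property of the second kind: for some \<open>k\<close>, the rows of the array are
  \<open>k\<close>-inconsistent and every path \<open>f\<close> is consistent with the elementary diagram of \<open>M\<close>, that is,
  finitely satisfiable in \<open>M\<close>.\<close>

definition TP2_in :: "('a, 'b) monoid_scheme \<Rightarrow> fm \<Rightarrow> nat list \<Rightarrow> nat list \<Rightarrow> bool" where
  "TP2_in M p xs ys \<longleftrightarrow>
     (\<exists>(a :: nat \<Rightarrow> nat \<Rightarrow> 'a list) (k :: nat).
        (\<forall>i j. a i j \<in> tuples M ys) \<and>
        (\<forall>i J. finite J \<and> card J = k \<longrightarrow>
           \<not> (\<exists>c\<in>tuples M xs. \<forall>j\<in>J. c \<in> solutions M p xs ys (a i j))) \<and>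
        (\<forall>f :: nat \<Rightarrow> nat. \<forall>I. finite I \<longrightarrow>
           (\<exists>c\<in>tuples M xs. \<forall>i\<in>I. c \<in> solutions M p xs ys (a i (f i)))))"


section \<open>Dividing lines in a theory\<close>

text \<open>A formula has one of these properties in a theory \<open>T\<close> if this is witnessed in some model of
  \<open>T\<close>. Each property involves at most continuum many elements and the language is countable, so by
  the downward Loewenheim-Skolem theorem a witnessing model may be taken to have cardinality at most
  the continuum, hence to have its carrier in the type \<open>nat \<Rightarrow> nat\<close>.\<close>

definition has_IP :: "fm set \<Rightarrow> fm \<Rightarrow> nat list \<Rightarrow> nat list \<Rightarrow> bool" where
  "has_IP T p xs ys \<longleftrightarrow> (\<exists>M :: (nat \<Rightarrow> nat) monoid. is_model M T \<and> IP_in M p xs ys)"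

definition has_OP :: "fm set \<Rightarrow> fm \<Rightarrow> nat list \<Rightarrow> nat list \<Rightarrow> bool" where
  "has_OP T p xs ys \<longleftrightarrow> (\<exists>M :: (nat \<Rightarrow> nat) monoid. is_model M T \<and> OP_in M p xs ys)"

definition has_nIP :: "fm set \<Rightarrow> fm \<Rightarrow> nat list list \<Rightarrow> nat list \<Rightarrow> bool" where
  "has_nIP T p xss ys \<longleftrightarrow> (\<exists>M :: (nat \<Rightarrow> nat) monoid. is_model M T \<and> nIP_in M p xss ys)"

definition has_SOP :: "fm set \<Rightarrow> fm \<Rightarrow> nat list \<Rightarrow> nat list \<Rightarrow> bool" where
  "has_SOP T p xs ys \<longleftrightarrow> (\<exists>M :: (nat \<Rightarrow> nat) monoid. is_model M T \<and> SOP_in M p xs ys)"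

definition has_TP2 :: "fm set \<Rightarrow> fm \<Rightarrow> nat list \<Rightarrow> nat list \<Rightarrow> bool" where
  "has_TP2 T p xs ys \<longleftrightarrow> (\<exists>M :: (nat \<Rightarrow> nat) monoid. is_model M T \<and> TP2_in M p xs ys)"


section \<open>The formulas\<close>

text \<open>Also the formula \<open>t \<in> C(u)\<close>.\<close>

definition commute_fm :: "tm \<Rightarrow> tm \<Rightarrow> fm" where
  "commute_fm t u = Eq (Mul t u) (Mul u t)"

text \<open>\<open>C(x) \<subseteq> C(y)\<close>, for variables \<open>x\<close>, \<open>y\<close> different from the bound variable \<open>z\<close>\<close>

definition centraliser_le_fm :: "nat \<Rightarrow> nat \<Rightarrow> nat \<Rightarrow> fm" where
  "centraliser_le_fm z x y =
     All z (Imp (commute_fm (Var z) (Var x)) (commute_fm (Var z) (Var y)))"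

definition conj_tm :: "tm \<Rightarrow> tm \<Rightarrow> tm" where
  "conj_tm t u = Mul (Mul (Inv u) t) u"

fun prod_tm :: "tm list \<Rightarrow> tm" where
  "prod_tm [] = One"
| "prod_tm (t # ts) = foldl Mul t ts"

text \<open>\<open>y\<^sub>1\<close> conjugated by \<open>x\<^sub>1 \<cdots> x\<^sub>n\<close> lies in \<open>C(y\<^sub>2)\<close>, where \<open>x\<^sub>1, \<dots>, x\<^sub>n\<close> are the variables
  \<open>0, \<dots>, n - 1\<close> and \<open>y\<^sub>1, y\<^sub>2\<close> are the variables \<open>n, n + 1\<close>\<close>

definition conj_prod_fm :: "nat \<Rightarrow> fm" where
  "conj_prod_fm n =
     commute_fm (conj_tm (Var n) (prod_tm (map Var [0..<n]))) (Var (n + 1))"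

text \<open>\<open>x \<in> C(y\<^sub>2) - C(y\<^sub>1)\<close>\<close>

definition centraliser_diff_fm :: "nat \<Rightarrow> nat \<Rightarrow> nat \<Rightarrow> fm" where
  "centraliser_diff_fm x y1 y2 =
     Conj (commute_fm (Var x) (Var y2)) (Neg (commute_fm (Var x) (Var y1)))"

end

theory Submission
  imports Defs "HOL-Algebra.Multiplicative_Group" "HOL-Number_Theory.Residue_Primitive_Roots"
    "HOL-Library.Countable_Set" "HOL-Library.Nat_Bijection"
begin

text \<open>An isomorphism between finitely generated subgroups is realised by conjugation, so it suffices
  to find finitely generated subgroups with many automorphisms. Copies of \<open>(\<int>/m)\<^sup>n\<close> with \<open>m \<noteq> 1\<close>
  exist for every \<open>n\<close>. They are built by repeatedly lifting a power map \<open>x \<mapsto> x\<^sup>k\<close> of an abelian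
  subgroup \<open>S\<close> to an element that centralises a given subgroup \<open>T\<close> normalising \<open>S\<close>. If \<open>s\<close> has infinite
  order, commuting lifts of \<open>s \<mapsto> s\<^sup>2\<close> and \<open>s \<mapsto> s\<^sup>3\<close> are independent, which increases the rank of a free
  abelian group. If the orders are finite but contain all powers of a prime \<open>p\<close>, a lift of
  \<open>x \<mapsto> x\<^sup>1\<^sup>+\<^sup>q\<close> with \<open>q = p\<^sup>h\<close> increases the rank of a homocyclic group of exponent \<open>q\<^sup>2\<close>, at the cost
  of lowering the exponent. Otherwise arbitrarily large prime orders occur, and the lifts of primitive
  roots modulo such primes provide arbitrarily large finite abelian 2-groups of bounded exponent, hence
  large elementary ones.

  All permutations of a basis of \<open>(\<int>/m)\<^sup>n\<close> are realised by conjugation. Suitable permutations give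
  finite witnesses of each property, and an ultrapower of a countable elementary substructure contains
  their limits.\<close>

subsection \<open>Conjugation and lifts of partial automorphisms\<close>

text \<open>The constraint behind each construction: the power map on S and the identity on T must
  agree on S \<inter> T, while T normalises S. If t squares s, then its inverse takes a square root
  of s, so the powers of s have to be enlarged to a copy of the dyadic rationals Z[1/2] before a
  further element that centralises t can act on them. This S is not finitely generated, but S T is,
  and only that is required. In the torsion cases S \<inter> T is kept small: it consists of
  elements killed by 2, or it is trivial because orders in S and T are coprime.

  A lifted element acts on S with known exponents, so its independence of T becomes arithmetic:
  powers of 3 are not powers of 2, 1 + q has order q modulo q^2, and a primitive root modulo p has
  order p - 1.

  Models have to live on \<open>nat \<Rightarrow> nat\<close>, whatever the size of the given group;
  hence the countable substructure. Two patterns serve all the properties: one for independence,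
  order and n-independence, the other for the strict order and tree properties.\<close>

context group
begin

lemma mult_inv_cancel_left:
  assumes "x \<in> carrier G" "y \<in> carrier G"
  shows "x \<otimes> (inv x \<otimes> y) = y" "inv x \<otimes> (x \<otimes> y) = y"
  using assms by (simp_all flip: m_assoc)

definition conj_by :: "'a \<Rightarrow> 'a \<Rightarrow> 'a" where
  "conj_by g x = inv g \<otimes> x \<otimes> g"

lemma conj_by_closed [simp, intro]:
  "g \<in> carrier G \<Longrightarrow> x \<in> carrier G \<Longrightarrow> conj_by g x \<in> carrier G"
  by (simp add: conj_by_def)

lemma conj_by_hom:
  assumes "g \<in> carrier G" shows "group_hom G G (conj_by g)"
proof -
  have "conj_by g (x \<otimes> y) = conj_by g x \<otimes> conj_by g y"
    if "x \<in> carrier G" "y \<in> carrier G" for x y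
    using assms that by (simp add: conj_by_def m_assoc mult_inv_cancel_left)
  then show ?thesis
    using assms by (intro group_hom.intro group_hom_axioms.intro is_group homI) auto
qed

lemma conj_by_mult:
  "g \<in> carrier G \<Longrightarrow> x \<in> carrier G \<Longrightarrow> y \<in> carrier G \<Longrightarrow>
    conj_by g (x \<otimes> y) = conj_by g x \<otimes> conj_by g y"
  using group_hom.hom_mult[OF conj_by_hom] by blast

lemma conj_by_int_pow:
  "g \<in> carrier G \<Longrightarrow> x \<in> carrier G \<Longrightarrow> conj_by g (x [^] (k::int)) = conj_by g x [^] k"
  using group_hom.hom_int_pow[OF conj_by_hom] by blast

lemma conj_by_nat_pow:
  "g \<in> carrier G \<Longrightarrow> x \<in> carrier G \<Longrightarrow> conj_by g (x [^] (k::nat)) = conj_by g x [^] k"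
  using group_hom.hom_nat_pow[OF conj_by_hom] by blast

lemma conj_by_by_mult:
  "g \<in> carrier G \<Longrightarrow> h \<in> carrier G \<Longrightarrow> x \<in> carrier G \<Longrightarrow>
    conj_by (g \<otimes> h) x = conj_by h (conj_by g x)"
  by (simp add: conj_by_def inv_mult_group m_assoc)

lemma conj_by_by_one [simp]: "x \<in> carrier G \<Longrightarrow> conj_by \<one> x = x"
  by (simp add: conj_by_def)

text \<open>Turns commutation into fixed points: whether x commutes with g is read off from the map
  that g induces by conjugation.\<close>

lemma conj_by_eq_self_iff:
  "g \<in> carrier G \<Longrightarrow> x \<in> carrier G \<Longrightarrow> conj_by g x = x \<longleftrightarrow> x \<otimes> g = g \<otimes> x"
  by (metis conj_by_def inv_closed m_assoc m_closed inv_solve_left)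

lemma conj_by_inj:
  "g \<in> carrier G \<Longrightarrow> x \<in> carrier G \<Longrightarrow> y \<in> carrier G \<Longrightarrow> conj_by g x = conj_by g y \<longleftrightarrow> x = y"
  by (simp add: conj_by_def)

lemma conj_by_inv_cancel:
  "g \<in> carrier G \<Longrightarrow> x \<in> carrier G \<Longrightarrow> conj_by (inv g) (conj_by g x) = x"
  "g \<in> carrier G \<Longrightarrow> x \<in> carrier G \<Longrightarrow> conj_by g (conj_by (inv g) x) = x"
  by (simp_all flip: conj_by_by_mult)

lemma conj_by_pow_power:
  assumes "g \<in> carrier G" "x \<in> carrier G" "conj_by g x = x [^] (k::nat)"
  shows "conj_by (g [^] (n::nat)) x = x [^] (k ^ n)"
proof (induction n)
  case (Suc n)
  then show ?case
    using assms by (simp add: conj_by_by_mult conj_by_nat_pow nat_pow_pow mult.commute)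
qed (use assms in simp)

end

locale inner_ultrahomogeneous_group = group +
  assumes inner_uh: "inner_ultrahomogeneous G"
begin

text \<open>The image of a finitely generated subgroup is generated by the images of the generators,
  so an injective homomorphism into the group is already a finite partial automorphism onto its
  image.\<close>

lemma lift_partial_hom:
  assumes "finite A" "A \<subseteq> carrier G"
    and mult: "\<And>x y. x \<in> generate G A \<Longrightarrow> y \<in> generate G A \<Longrightarrow> \<phi> (x \<otimes> y) = \<phi> x \<otimes> \<phi> y"
    and closed: "\<And>x. x \<in> generate G A \<Longrightarrow> \<phi> x \<in> carrier G"
    and inj: "\<And>x. x \<in> generate G A \<Longrightarrow> \<phi> x = \<one> \<Longrightarrow> x = \<one>"
  shows "\<exists>g\<in>carrier G. \<forall>x\<in>generate G A. conj_by g x = \<phi> x"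
proof -
  let ?H = "generate G A"
  have sub: "subgroup ?H G"
    using assms(2) by (rule generate_is_subgroup)
  interpret H: group_hom "G\<lparr>carrier := ?H\<rparr>" G \<phi>
    by (intro group_hom.intro group_hom_axioms.intro homI is_group subgroup_imp_group sub)
      (auto simp: mult closed)
  have "\<phi> ` ?H = generate G (\<phi> ` A)"
    using H.generate_img[of A] generate_consistent[OF generate.incl[THEN subsetI] sub]
    by (simp add: generate.incl subset_iff)
  moreover have "subgroup (\<phi> ` ?H) G"
    using H.img_is_subgroup by simp
  moreover have "\<phi> ` A \<subseteq> carrier G"
    using closed generate.incl by fast
  ultimately have "fg_subgroup (\<phi> ` ?H) G"
    unfolding fg_subgroup_def using assms(1) by blast
  moreover have "fg_subgroup ?H G"
    unfolding fg_subgroup_def using sub assms by blast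
  moreover have "inj_on \<phi> ?H"
    using H.inj_on_one_iff inj by simp
  then have "\<phi> \<in> iso (G\<lparr>carrier := ?H\<rparr>) (G\<lparr>carrier := \<phi> ` ?H\<rparr>)"
    by (auto simp: iso_def hom_def bij_betw_def mult)
  ultimately show ?thesis
    using inner_uh unfolding inner_ultrahomogeneous_def finite_partial_aut_def conj_by_def by blast
qed

text \<open>The lift extends the map \<open>x t \<mapsto> x\<^sup>k t\<close> of the semidirect-like product \<open>S T\<close>.\<close>

lemma lift_power_map:
  fixes k :: int
  assumes S: "subgroup S G" and T: "subgroup T G"
    and comm: "\<And>x y. x \<in> S \<Longrightarrow> y \<in> S \<Longrightarrow> x \<otimes> y = y \<otimes> x"
    and norm: "\<And>x t. x \<in> S \<Longrightarrow> t \<in> T \<Longrightarrow> conj_by t x \<in> S"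
    and A: "finite A" "A \<subseteq> S \<union> T" "S \<union> T \<subseteq> generate G A"
    and inj: "\<And>x. x \<in> S \<Longrightarrow> x [^] k = \<one> \<Longrightarrow> x = \<one>"
    and fixes_int: "\<And>x. x \<in> S \<Longrightarrow> x \<in> T \<Longrightarrow> x [^] k = x"
  shows "\<exists>u\<in>carrier G. (\<forall>x\<in>S. conj_by u x = x [^] k) \<and> (\<forall>t\<in>T. conj_by u t = t)"
proof -
  interpret S: subgroup S G by fact
  interpret T: subgroup T G by fact
  have carr: "x \<in> carrier G" if "x \<in> S \<or> x \<in> T" for x
    using that by auto
  have Spow: "x [^] k \<in> S" if "x \<in> S" for x
    using S that by (rule subgroup_int_pow_closed)
  have Acarr: "A \<subseteq> carrier G"
    using A(2) carr by auto
  have norm': "t \<otimes> x \<otimes> inv t \<in> S" if "x \<in> S" "t \<in> T" for x t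
    using norm[of x "inv t"] that by (simp add: conj_by_def)
  define K where "K = (\<lambda>(x, t). x \<otimes> t) ` (S \<times> T)"
  have KI: "x \<otimes> t \<in> K" if "x \<in> S" "t \<in> T" for x t
    using that by (force simp: K_def)
  have KE: thesis if "a \<in> K" "\<And>x t. a = x \<otimes> t \<Longrightarrow> x \<in> S \<Longrightarrow> t \<in> T \<Longrightarrow> thesis" for a thesis
    using that by (auto simp: K_def)
  have K: "subgroup K G"
  proof (rule subgroupI)
    show "K \<subseteq> carrier G" by (auto simp: K_def)
    show "K \<noteq> {}" using KI[OF S.one_closed T.one_closed] by blast
    fix a assume "a \<in> K"
    then obtain x t where a: "a = x \<otimes> t" "x \<in> S" "t \<in> T" by (rule KE)
    then have "inv a = conj_by t (inv x) \<otimes> inv t"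
      by (simp add: inv_mult_group conj_by_def m_assoc)
    then show "inv a \<in> K"
      using norm[of "inv x" t] a KI by simp
    fix b assume "b \<in> K"
    then obtain y s where b: "b = y \<otimes> s" "y \<in> S" "s \<in> T" by (rule KE)
    have "a \<otimes> b = (x \<otimes> (t \<otimes> y \<otimes> inv t)) \<otimes> (t \<otimes> s)"
      using a b by (simp add: m_assoc mult_inv_cancel_left)
    then show "a \<otimes> b \<in> K"
      using a b norm' KI by simp
  qed
  have "x \<in> K" if "x \<in> S" for x
    using KI[OF that T.one_closed] that by simp
  moreover have "x \<in> K" if "x \<in> T" for x
    using KI[OF S.one_closed that] that by simp
  ultimately have "A \<subseteq> K"
    using A(2) by blast
  then have "generate G A \<subseteq> K"
    by (rule generate_subgroup_incl[OF _ K])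
  moreover have "K \<subseteq> generate G A"
    using A(3) generate.eng[of _ G A] by (auto simp: K_def)
  ultimately have gen: "generate G A = K" by (rule equalityI)
  \<comment> \<open>A factorisation x t is unique only up to an element of S \<inter> T, hence the
    choice. Two factorisations differ by some d in S \<inter> T, which the power map fixes, so the
    value does not depend on the choice.\<close>
  define \<phi> where "\<phi> a = (SOME b. \<exists>x t. x \<in> S \<and> t \<in> T \<and> a = x \<otimes> t \<and> b = x [^] k \<otimes> t)" for a
  have \<phi>: "\<phi> (x \<otimes> t) = x [^] k \<otimes> t" if xt: "x \<in> S" "t \<in> T" for x t
    unfolding \<phi>_def
  proof (rule some_equality)
    fix b assume "\<exists>y s. y \<in> S \<and> s \<in> T \<and> x \<otimes> t = y \<otimes> s \<and> b = y [^] k \<otimes> s"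
    then obtain y s where ys: "y \<in> S" "s \<in> T" "x \<otimes> t = y \<otimes> s" "b = y [^] k \<otimes> s" by auto
    define d where "d = inv y \<otimes> x"
    have "d \<in> S" "x = y \<otimes> d"
      using xt ys by (auto simp: d_def simp flip: m_assoc)
    moreover have "s = d \<otimes> t"
      using xt ys by (simp add: d_def m_assoc mult_inv_cancel_left)
    then have "d = s \<otimes> inv t"
      using xt ys \<open>d \<in> S\<close> by (simp add: m_assoc)
    then have "d \<in> T" 
      using xt ys by simp
    ultimately have "x [^] k = y [^] k \<otimes> d"
      using xt ys comm comm[of d "y [^] k"] Spow[of y] fixes_int by (simp add: int_pow_mult_distrib)
    then show "b = x [^] k \<otimes> t"
      using ys xt \<open>s = d \<otimes> t\<close> \<open>d \<in> S\<close> by (simp add: m_assoc)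
  qed (use xt in blast)
  have "\<exists>g\<in>carrier G. \<forall>x\<in>generate G A. conj_by g x = \<phi> x"
  proof (rule lift_partial_hom[OF A(1) Acarr]; unfold gen)
    fix a assume "a \<in> K"
    then obtain x t where a: "a = x \<otimes> t" "x \<in> S" "t \<in> T" by (rule KE)
    then show "\<phi> a \<in> carrier G"
      by (simp add: \<phi>)
    { assume "\<phi> a = \<one>"
      then have 1: "x [^] k \<otimes> t = \<one>"
        using a by (simp add: \<phi>)
      then have xk: "x [^] k = inv t"
        using a by (simp add: inv_equality)
      \<comment> \<open>x^k lies in S \<inter> T and is fixed by the power map, so x and d have the
        same k-th power and injectivity forces x = d.\<close>
      define d where "d = x [^] k"
      have d: "d \<in> S" "d \<in> T"
        using a Spow[of x] xk unfolding d_def by auto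
      then have "d [^] k = d" by (rule fixes_int)
      have "(x \<otimes> inv d) [^] k = x [^] k \<otimes> inv (d [^] k)"
        using int_pow_mult_distrib[OF comm[of x "inv d"], of k] a d by (simp add: int_pow_inv)
      also have "\<dots> = \<one>"
        using d \<open>d [^] k = d\<close> by (simp add: d_def)
      finally have "x \<otimes> inv d = \<one>"
        using a d inj by simp
      then have "x = d"
        using a d by (metis S.mem_carrier inv_closed inv_equality inv_inv)
      then show "a = \<one>"
        using 1 a by (simp add: d_def) }
    fix b assume "b \<in> K"
    then obtain y s where b: "b = y \<otimes> s" "y \<in> S" "s \<in> T" by (rule KE)
    have "a \<otimes> b = (x \<otimes> conj_by (inv t) y) \<otimes> (t \<otimes> s)"
      using a b by (simp add: conj_by_def m_assoc mult_inv_cancel_left)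
    then have "\<phi> (a \<otimes> b) = (x \<otimes> conj_by (inv t) y) [^] k \<otimes> (t \<otimes> s)"
      using a b norm by (simp add: \<phi>)
    also have "\<dots> = (x [^] k \<otimes> conj_by (inv t) (y [^] k)) \<otimes> (t \<otimes> s)"
      using a b norm comm by (simp add: int_pow_mult_distrib conj_by_int_pow)
    also have "\<dots> = \<phi> a \<otimes> \<phi> b"
      using a b by (simp add: \<phi> conj_by_def m_assoc mult_inv_cancel_left)
    finally show "\<phi> (a \<otimes> b) = \<phi> a \<otimes> \<phi> b" .
  qed
  then obtain u where u: "u \<in> carrier G" "\<And>x. x \<in> K \<Longrightarrow> conj_by u x = \<phi> x"
    unfolding gen by auto
  show ?thesis
  proof (intro bexI[OF _ u(1)] conjI ballI)
    fix x assume "x \<in> S"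
    then show "conj_by u x = x [^] k"
      using u(2)[of x] \<phi>[of x \<one>] KI[of x \<one>] by simp
  next
    fix t assume "t \<in> T"
    then show "conj_by u t = t"
      using u(2)[of t] \<phi>[of \<one> t] KI[of \<one> t] by simp
  qed
qed

end

subsection \<open>Homocyclic subgroups\<close>

context group
begin

text \<open>The group \<open>(\<int>/m)\<^sup>n\<close> is embedded as the image of a homomorphism \<open>\<theta>\<close> from integer sequences,
  of which only the first \<open>n\<close> entries matter; \<open>m = 0\<close> gives a free abelian group.\<close>

definition homocyclic :: "nat \<Rightarrow> int \<Rightarrow> ((nat \<Rightarrow> int) \<Rightarrow> 'a) \<Rightarrow> bool" where
  "homocyclic n m \<theta> \<longleftrightarrow> (\<forall>k. \<theta> k \<in> carrier G) \<and>
     (\<forall>k l. \<theta> (\<lambda>i. k i + l i) = \<theta> k \<otimes> \<theta> l) \<and>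
     (\<forall>k. \<theta> k = \<one> \<longleftrightarrow> (\<forall>i<n. m dvd k i))"

lemma homocyclicI:
  assumes "\<And>k. \<theta> k \<in> carrier G" "\<And>k l. \<theta> (\<lambda>i. k i + l i) = \<theta> k \<otimes> \<theta> l"
    "\<And>k. \<theta> k = \<one> \<longleftrightarrow> (\<forall>i<n. m dvd k i)"
  shows "homocyclic n m \<theta>"
  using assms by (simp add: homocyclic_def)

context
  fixes n m \<theta>
  assumes hc: "homocyclic n m \<theta>"
begin

lemma homocyclic_closed [simp]: "\<theta> k \<in> carrier G"
  using hc by (simp add: homocyclic_def)

lemma homocyclic_add: "\<theta> (\<lambda>i. k i + l i) = \<theta> k \<otimes> \<theta> l"
  using hc by (simp add: homocyclic_def)

lemma homocyclic_eq_one: "\<theta> k = \<one> \<longleftrightarrow> (\<forall>i<n. m dvd k i)"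
  using hc by (simp add: homocyclic_def)

lemma homocyclic_commute: "\<theta> k \<otimes> \<theta> l = \<theta> l \<otimes> \<theta> k"
  by (simp add: add.commute flip: homocyclic_add)

lemma homocyclic_zero: "\<theta> (\<lambda>i. 0) = \<one>"
  by (simp add: homocyclic_eq_one)

lemma homocyclic_uminus: "\<theta> (\<lambda>i. - k i) = inv (\<theta> k)"
  using homocyclic_add[of "\<lambda>i. - k i" k] by (simp add: homocyclic_zero inv_equality)

lemma homocyclic_diff: "\<theta> (\<lambda>i. k i - l i) = \<theta> k \<otimes> inv (\<theta> l)"
  using homocyclic_add[of k "\<lambda>i. - l i"] by (simp add: homocyclic_uminus)

lemma homocyclic_eq_iff: "\<theta> k = \<theta> l \<longleftrightarrow> (\<forall>i<n. m dvd k i - l i)"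
proof -
  have "\<theta> k = \<theta> l \<longleftrightarrow> \<theta> k \<otimes> inv (\<theta> l) = \<one>"
    by (metis homocyclic_closed inv_closed inv_equality inv_inv r_inv)
  then show ?thesis
    by (simp add: homocyclic_eq_one flip: homocyclic_diff)
qed

lemma homocyclic_nat_pow: "\<theta> k [^] (j::nat) = \<theta> (\<lambda>i. int j * k i)"
proof (induction j)
  case (Suc j)
  then show ?case
    by (simp add: distrib_right add.commute flip: homocyclic_add)
qed (simp add: homocyclic_zero)

lemma homocyclic_int_pow: "\<theta> k [^] (j::int) = \<theta> (\<lambda>i. j * k i)"
proof (cases j rule: int_cases2)
  case (nonneg a)
  then show ?thesis by (simp add: int_pow_int homocyclic_nat_pow)
next
  case (nonpos a)
  then show ?thesis
    by (simp add: int_pow_neg int_pow_int homocyclic_nat_pow flip: homocyclic_uminus)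
qed

lemma homocyclic_subgroup: "subgroup (range \<theta>) G"
proof (rule subgroupI)
  show "range \<theta> \<subseteq> carrier G" by auto
  show "range \<theta> \<noteq> {}" by auto
qed (auto simp flip: homocyclic_uminus homocyclic_add)

lemma homocyclic_generators:
  "range \<theta> = generate G ((\<lambda>j. \<theta> (\<lambda>i. of_bool (i = j))) ` {..<n})" (is "_ = generate G ?A")
proof
  have sub: "subgroup (generate G ?A) G"
    by (intro generate_is_subgroup) auto
  have "\<theta> (\<lambda>i. if i < j then k i else 0) \<in> generate G ?A" if "j \<le> n" for k j
    using that
  proof (induction j)
    case (Suc j)
    have "(\<lambda>i. if i < Suc j then k i else 0) =
      (\<lambda>i. (if i < j then k i else 0) + k j * of_bool (i = j))"
      by (auto simp: fun_eq_iff less_Suc_eq)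
    then have "\<theta> (\<lambda>i. if i < Suc j then k i else 0) =
      \<theta> (\<lambda>i. if i < j then k i else 0) \<otimes> \<theta> (\<lambda>i. of_bool (i = j)) [^] k j"
      by (simp add: homocyclic_add homocyclic_int_pow)
    moreover have "\<theta> (\<lambda>i. of_bool (i = j)) [^] k j \<in> generate G ?A"
      using Suc.prems by (intro subgroup_int_pow_closed[OF sub] generate.incl) auto
    ultimately show ?case
      using Suc by (simp add: generate.eng)
  qed (simp add: homocyclic_zero generate.one)
  from this[OF order_refl] show "range \<theta> \<subseteq> generate G ?A"
  proof safe
    fix k
    assume "\<And>k. \<theta> (\<lambda>i. if i < n then k i else 0) \<in> generate G ?A"
    moreover have "\<theta> k = \<theta> (\<lambda>i. if i < n then k i else 0)"
      by (simp add: homocyclic_eq_iff)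
    ultimately show "\<theta> k \<in> generate G ?A" by metis
  qed
  show "generate G ?A \<subseteq> range \<theta>"
    by (intro generate_subgroup_incl homocyclic_subgroup) auto
qed

text \<open>By \<open>indep\<close>, c has order m even modulo the image of \<open>\<theta>\<close>
  (infinite order if m = 0). Since also c^m = 1 and c centralises the image, the product is direct,
  and coordinate n becomes the exponent of c.\<close>

lemma homocyclic_extend:
  assumes c: "c \<in> carrier G" "\<And>k. \<theta> k \<otimes> c = c \<otimes> \<theta> k" "c [^] m = \<one>"
    and indep: "\<And>j::int. c [^] j \<in> range \<theta> \<Longrightarrow> m dvd j"
  shows "homocyclic (Suc n) m (\<lambda>k. \<theta> k \<otimes> c [^] k n)"
proof (rule homocyclicI)
  have comm: "\<theta> k \<otimes> c [^] j = c [^] j \<otimes> \<theta> k" for k and j :: int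
  proof -
    have "conj_by (\<theta> k) c = c"
      using c by (simp add: conj_by_eq_self_iff)
    then have "conj_by (\<theta> k) (c [^] j) = c [^] j"
      using c by (simp add: conj_by_int_pow)
    then show ?thesis
      using c by (simp add: conj_by_eq_self_iff)
  qed
  show "\<theta> k \<otimes> c [^] k n \<in> carrier G" for k
    using c by simp
  show "\<theta> (\<lambda>i. k i + l i) \<otimes> c [^] (k n + l n) = (\<theta> k \<otimes> c [^] k n) \<otimes> (\<theta> l \<otimes> c [^] l n)" for k l
  proof -
    have "\<theta> l \<otimes> (c [^] k n \<otimes> c [^] l n) = c [^] k n \<otimes> (\<theta> l \<otimes> c [^] l n)"
      using c by (metis comm homocyclic_closed int_pow_closed m_assoc)
    then show ?thesis
      using c by (simp add: homocyclic_add int_pow_mult m_assoc)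
  qed
  fix k
  have cm: "c [^] j = \<one>" if "m dvd j" for j
    using that c by (metis dvdE int_pow_one int_pow_pow)
  show "\<theta> k \<otimes> c [^] k n = \<one> \<longleftrightarrow> (\<forall>i<Suc n. m dvd k i)"
  proof
    assume eq: "\<theta> k \<otimes> c [^] k n = \<one>"
    then have "c [^] k n = \<theta> (\<lambda>i. - k i)"
      using c comm[of k "k n"] by (simp add: homocyclic_uminus inv_equality)
    then have "m dvd k n"
      using indep[of "k n"] by auto
    with cm eq have "\<theta> k = \<one>"
      by simp
    with \<open>m dvd k n\<close> show "\<forall>i<Suc n. m dvd k i"
      by (simp add: homocyclic_eq_one less_Suc_eq)
  next
    assume "\<forall>i<Suc n. m dvd k i"
    then show "\<theta> k \<otimes> c [^] k n = \<one>"
      using cm homocyclic_eq_one by simp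
  qed
qed

text \<open>Passing to d-th powers keeps the rank; exponent is traded for a subgroup that more
  elements centralise.\<close>

lemma homocyclic_scale:
  assumes "m = d * m'" "d \<noteq> 0"
  shows "homocyclic n m' (\<lambda>k. \<theta> (\<lambda>i. d * k i))"
  using assms by (intro homocyclicI) (simp_all add: distrib_left homocyclic_add homocyclic_eq_one)

end

lemma homocyclic_restrict:
  assumes "homocyclic (Suc n) m \<theta>"
  shows "homocyclic n m (\<lambda>k. \<theta> (k(n := 0)))"
proof (rule homocyclicI)
  fix k l :: "nat \<Rightarrow> int"
  have "(\<lambda>i. k i + l i)(n := 0) = (\<lambda>i. (k(n := 0)) i + (l(n := 0)) i)"
    by (simp add: fun_eq_iff)
  then show "\<theta> ((\<lambda>i. k i + l i)(n := 0)) = \<theta> (k(n := 0)) \<otimes> \<theta> (l(n := 0))"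
    by (simp only: homocyclic_add[OF assms])
qed (auto simp: homocyclic_closed[OF assms] homocyclic_eq_one[OF assms] less_Suc_eq)

lemma homocyclic_trivial: "homocyclic 0 m (\<lambda>_. \<one>)"
  by (simp add: homocyclic_def)

lemma homocyclic_cyclic:
  assumes "g \<in> carrier G"
  shows "homocyclic 1 (int (ord g)) (\<lambda>k. g [^] k 0)"
  using assms by (intro homocyclicI) (auto simp: int_pow_mult int_pow_eq_id)

end

section \<open>Permutations of a basis, realised by conjugation\<close>

context inner_ultrahomogeneous_group
begin

text \<open>Permuting coordinates respects coordinatewise divisibility by m. It therefore induces an
  automorphism of the image of \<open>\<theta>\<close>, although \<open>\<theta>\<close> is not
  injective and preimages have to be chosen.\<close>

lemma homocyclic_lift_perm:
  assumes hc: "homocyclic n m \<theta>" and \<sigma>: "bij_betw \<sigma> {..<n} {..<n}"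
  shows "\<exists>u\<in>carrier G. \<forall>k. conj_by u (\<theta> k) = \<theta> (k \<circ> \<sigma>)"
proof -
  define A where "A = (\<lambda>j. \<theta> (\<lambda>i. of_bool (i = j))) ` {..<n}"
  have gen: "generate G A = range \<theta>"
    unfolding A_def by (rule homocyclic_generators[OF hc, symmetric])
  have all: "(\<forall>i<n. P (\<sigma> i)) \<longleftrightarrow> (\<forall>i<n. P i)" for P
  proof -
    have "(\<forall>i\<in>\<sigma> ` {..<n}. P i) \<longleftrightarrow> (\<forall>i\<in>{..<n}. P i)"
      by (simp only: bij_betw_imp_surj_on[OF \<sigma>])
    then show ?thesis unfolding ball_simps by auto
  qed
  have eq: "\<theta> (k \<circ> \<sigma>) = \<theta> (l \<circ> \<sigma>)" if "\<theta> k = \<theta> l" for k l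
    using that all[of "\<lambda>i. m dvd k i - l i"] by (simp add: homocyclic_eq_iff[OF hc])
  define \<phi> where "\<phi> x = \<theta> ((SOME k. \<theta> k = x) \<circ> \<sigma>)" for x
  have \<phi>: "\<phi> (\<theta> k) = \<theta> (k \<circ> \<sigma>)" for k
    unfolding \<phi>_def by (rule eq, rule someI[where P = "\<lambda>l. \<theta> l = \<theta> k"]) (rule refl)
  have "\<exists>g\<in>carrier G. \<forall>x\<in>generate G A. conj_by g x = \<phi> x"
  proof (rule lift_partial_hom)
    show "finite A" by (simp add: A_def)
    show "A \<subseteq> carrier G" by (auto simp: A_def homocyclic_closed[OF hc])
    fix x assume "x \<in> generate G A"
    then obtain k where k: "x = \<theta> k" by (auto simp: gen)
    then show "\<phi> x \<in> carrier G" by (simp add: \<phi> homocyclic_closed[OF hc])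
    show "x = \<one>" if "\<phi> x = \<one>"
      using that all[of "\<lambda>i. m dvd k i"] by (simp add: k \<phi> homocyclic_eq_one[OF hc])
    fix y assume "y \<in> generate G A"
    then obtain l where l: "y = \<theta> l" by (auto simp: gen)
    show "\<phi> (x \<otimes> y) = \<phi> x \<otimes> \<phi> y"
      by (simp add: k l \<phi> comp_def flip: homocyclic_add[OF hc])
  qed
  then show ?thesis
    by (auto simp: gen \<phi>)
qed

lemma homocyclic_symmetric_family:
  assumes hc: "homocyclic n m \<theta>" and m: "\<not> m dvd 1"
  obtains c :: "nat \<Rightarrow> 'a" where "\<And>i. c i \<in> carrier G" "inj_on c {..<n}"
    "\<And>\<sigma>. bij_betw \<sigma> {..<n} {..<n} \<Longrightarrow> \<exists>u\<in>carrier G. \<forall>i<n. conj_by u (c i) = c (\<sigma> i)"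
proof
  define c where "c j = \<theta> (\<lambda>i. of_bool (i = j))" for j
  show "c i \<in> carrier G" for i
    by (simp add: c_def homocyclic_closed[OF hc])
  show "inj_on c {..<n}"
  proof (rule inj_onI)
    fix i j assume "i \<in> {..<n}" "j \<in> {..<n}" "c i = c j"
    then show "i = j"
      using m by (cases "i = j") (auto simp: c_def homocyclic_eq_iff[OF hc] dest!: spec[of _ i])
  qed
  fix \<sigma> :: "nat \<Rightarrow> nat" assume \<sigma>: "bij_betw \<sigma> {..<n} {..<n}"
  \<comment> \<open>Precomposition with a permutation sends the i-th basis vector to the one indexed
    by the preimage of i, so the inverse of \<open>\<sigma>\<close> is lifted.\<close>
  define \<tau> where "\<tau> = the_inv_into {..<n} \<sigma>"
  have \<tau>: "bij_betw \<tau> {..<n} {..<n}"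
    unfolding \<tau>_def using \<sigma> by (rule bij_betw_the_inv_into)
  obtain u where u: "u \<in> carrier G" "\<And>k. conj_by u (\<theta> k) = \<theta> (k \<circ> \<tau>)"
    using homocyclic_lift_perm[OF hc \<tau>] by auto
  have "\<tau> i = j \<longleftrightarrow> i = \<sigma> j" if "i < n" "j < n" for i j
    using that \<sigma> by (auto simp: \<tau>_def bij_betw_def the_inv_into_f_f f_the_inv_into_f)
  then have "conj_by u (c i) = c (\<sigma> i)" if "i < n" for i
    using that by (simp add: u c_def homocyclic_eq_iff[OF hc])
  with u(1) show "\<exists>u\<in>carrier G. \<forall>i<n. conj_by u (c i) = c (\<sigma> i)" by auto
qed

end

subsection \<open>Elements of infinite order\<close>

context inner_ultrahomogeneous_group
begin

text \<open>The last basis element s is discarded and two elements are gained: t squares s, t' cubes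
  it, and both centralise the other n basis elements and each other. Their actions on s prove
  independence.\<close>

lemma homocyclic_zero_step:
  assumes hc: "homocyclic (Suc n) 0 \<theta>"
  shows "\<exists>\<theta>'. homocyclic (Suc (Suc n)) 0 \<theta>'"
proof -
  note closed = homocyclic_closed[OF hc]
  define s where "s = \<theta> (\<lambda>i. of_bool (i = n))"
  have s: "s \<in> carrier G" by (simp add: s_def closed)
  have s_pow: "s [^] (j::int) = \<theta> (\<lambda>i. j * of_bool (i = n))" for j
    by (simp add: s_def homocyclic_int_pow[OF hc])
  have s_one: "s [^] (j::int) = \<one> \<Longrightarrow> j = 0" for j
    by (auto simp: s_pow homocyclic_eq_one[OF hc])
  have s_eq: "s [^] (i::int) = s [^] j \<Longrightarrow> i = j" for i j
    using s_one[of "i - j"] s by (simp add: int_pow_diff)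
  define \<theta>0 where "\<theta>0 k = \<theta> (k(n := 0))" for k
  have hc0: "homocyclic n 0 \<theta>0"
    using homocyclic_restrict[OF hc] by (simp add: \<theta>0_def[abs_def])
  note closed0 = homocyclic_closed[OF hc0]
  have s_range: "s [^] (j::int) \<in> range \<theta>0 \<Longrightarrow> j = 0" for j
    by (auto simp: s_pow \<theta>0_def homocyclic_eq_iff[OF hc] dest!: spec[of _ n])
  have fix_s: "conj_by (\<theta>0 k) s = s" for k
    by (simp add: conj_by_eq_self_iff closed0 s)
      (simp add: \<theta>0_def s_def homocyclic_commute[OF hc])
  define A0 where "A0 = (\<lambda>j. \<theta>0 (\<lambda>i. of_bool (i = j))) ` {..<n}"
  have A0: "generate G A0 = range \<theta>0" "finite A0" "A0 \<subseteq> range \<theta>0"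
    using homocyclic_generators[OF hc0] unfolding A0_def by auto
  have gen_s: "generate G {s} = range (\<lambda>j::int. s [^] j)"
    using generate_pow[OF s] by auto
  have sub_s: "subgroup (generate G {s}) G"
    using s by (intro generate_is_subgroup) simp

  have "\<exists>t\<in>carrier G. (\<forall>x\<in>generate G {s}. conj_by t x = x [^] (2::int)) \<and>
      (\<forall>x\<in>range \<theta>0. conj_by t x = x)"
  proof (rule lift_power_map[OF sub_s homocyclic_subgroup[OF hc0]])
    show "finite (A0 \<union> {s})" using A0 by simp
    show "A0 \<union> {s} \<subseteq> generate G {s} \<union> range \<theta>0"
      using A0 by (auto intro: generate.incl)
    show "generate G {s} \<union> range \<theta>0 \<subseteq> generate G (A0 \<union> {s})"
      unfolding A0(1)[symmetric] by (intro Un_least mono_generate) auto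
    fix x assume "x \<in> generate G {s}"
    then obtain j :: int where j: "x = s [^] j" by (auto simp: gen_s)
    show "x = \<one>" if "x [^] (2::int) = \<one>"
      using that s s_one[of "j * 2"] by (simp add: j int_pow_pow)
    show "x [^] (2::int) = x" if "x \<in> range \<theta>0"
      using that s_range[of j] by (simp add: j)
    show "conj_by y x \<in> generate G {s}" if "y \<in> range \<theta>0" for y
      using that s closed0 \<open>x \<in> generate G {s}\<close> by (auto simp: j conj_by_int_pow fix_s)
    show "x \<otimes> y = y \<otimes> x" if "y \<in> generate G {s}" for y
      using that s by (auto simp: j gen_s add.commute simp flip: int_pow_mult)
  qed
  then obtain t where t: "t \<in> carrier G" "conj_by t s = s [^] (2::nat)" "\<And>k. conj_by t (\<theta>0 k) = \<theta>0 k"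
    using generate.incl[of s "{s}" G] int_pow_int[of G s 2] by auto
  have t_pow: "conj_by (t [^] (i::nat)) (s [^] (j::int)) = s [^] (j * 2 ^ i)" for i j
    using t s conj_by_pow_power[OF t(1) s t(2), of i]
    by (simp add: conj_by_int_pow int_pow_pow mult.commute flip: int_pow_int)
  have t_comm: "\<theta>0 k \<otimes> t = t \<otimes> \<theta>0 k" for k
    using t closed0 by (simp flip: conj_by_eq_self_iff)
  \<comment> \<open>The image of \<open>\<theta>0\<close> fixes s, whereas t^|j| maps s to its power
    with exponent 2^|j|.\<close>
  have "j = 0" if j: "t [^] (j::int) \<in> range \<theta>0" for j
  proof -
    obtain k where k: "t [^] j = \<theta>0 k" using j by (rule rangeE)
    have "t [^] nat \<bar>j\<bar> = \<theta>0 (if j \<ge> 0 then k else (\<lambda>i. - k i))"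
      using k t closed0 by (auto simp: homocyclic_uminus[OF hc0] int_pow_neg simp flip: int_pow_int)
    then have "conj_by (t [^] nat \<bar>j\<bar>) s = s"
      by (simp add: fix_s)
    then have "s [^] ((2::int) ^ nat \<bar>j\<bar>) = s [^] (1::int)"
      using t_pow[of "nat \<bar>j\<bar>" 1] s by simp
    then show "j = 0"
      by (auto dest!: s_eq)
  qed
  then have "homocyclic (Suc n) 0 (\<lambda>k. \<theta>0 k \<otimes> t [^] k n)"
    using t t_comm by (intro homocyclic_extend[OF hc0]) auto
  then obtain \<theta>1 where \<theta>1: "homocyclic (Suc n) 0 \<theta>1" "\<theta>1 = (\<lambda>k. \<theta>0 k \<otimes> t [^] k n)"
    by blast
  note hc1 = \<theta>1(1) and closed1 = homocyclic_closed[OF \<theta>1(1)]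
  define A1 where "A1 = (\<lambda>j. \<theta>1 (\<lambda>i. of_bool (i = j))) ` {..<Suc n}"
  have A1: "generate G A1 = range \<theta>1" "finite A1" "A1 \<subseteq> range \<theta>1"
    using homocyclic_generators[OF hc1] unfolding A1_def by auto
  have "t \<in> range \<theta>1"
  proof (rule range_eqI)
    have "\<theta>0 (\<lambda>i. of_bool (i = n)) = \<one>"
      by (simp add: homocyclic_eq_one[OF hc0])
    then show "t = \<theta>1 (\<lambda>i. of_bool (i = n))"
      using t by (simp add: \<theta>1(2))
  qed

  \<comment> \<open>A copy of Z[1/2]: the smallest subgroup containing s that is invariant under
    conjugation by t and by its inverse. The powers of s alone are not normalised by t, so they
    cannot serve for the second lift.\<close>
  define S where "S = {x \<in> carrier G. \<exists>(i::nat) (j::int). conj_by (t [^] i) x = s [^] j}"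
  have S_later: "conj_by (t [^] (i + d)) x = s [^] (j * 2 ^ d)"
    if "x \<in> carrier G" "conj_by (t [^] i) x = s [^] j" for x i d and j :: int
    using that t t_pow[of d j] by (simp add: conj_by_by_mult flip: nat_pow_mult)
  \<comment> \<open>Increasing i only multiplies the exponent j by a power of 2, so two elements of
    S become powers of s under one common conjugation; this reduces all computations in S to
    exponents.\<close>
  have S_common: "\<exists>i a b. conj_by (t [^] (i::nat)) x = s [^] (a::int) \<and> conj_by (t [^] i) y = s [^] (b::int)"
    if "x \<in> S" "y \<in> S" for x y
  proof -
    obtain i a i' b where *: "conj_by (t [^] (i::nat)) x = s [^] (a::int)"
      "conj_by (t [^] (i'::nat)) y = s [^] (b::int)"
      using \<open>x \<in> S\<close> \<open>y \<in> S\<close> by (auto simp: S_def)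
    then show ?thesis
      using S_later[of x i a i'] S_later[of y i' b i] \<open>x \<in> S\<close> \<open>y \<in> S\<close>
      by (auto simp: S_def add.commute[of i' i])
  qed
  have S: "subgroup S G"
  proof (rule subgroupI)
    show "S \<subseteq> carrier G" by (auto simp: S_def)
    have "s \<in> S"
      using s t by (auto simp: S_def intro!: exI[of _ "0::nat"] exI[of _ "1::int"])
    then show "S \<noteq> {}" by auto
    fix x assume "x \<in> S"
    then obtain i j where ij: "x \<in> carrier G" "conj_by (t [^] (i::nat)) x = s [^] (j::int)"
      by (auto simp: S_def)
    then have "conj_by (t [^] i) (inv x) = s [^] (- j)"
      using t s group_hom.hom_inv[OF conj_by_hom] by (simp add: int_pow_neg)
    then show "inv x \<in> S"
      using ij by (auto simp: S_def)
    fix y assume "y \<in> S"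
    obtain i a b where *: "conj_by (t [^] (i::nat)) x = s [^] (a::int)" "conj_by (t [^] i) y = s [^] (b::int)"
      using S_common \<open>x \<in> S\<close> \<open>y \<in> S\<close> by blast
    then have "conj_by (t [^] i) (x \<otimes> y) = s [^] (a + b)"
      using \<open>x \<in> S\<close> \<open>y \<in> S\<close> t s by (simp add: conj_by_mult int_pow_mult S_def)
    then show "x \<otimes> y \<in> S"
      using \<open>x \<in> S\<close> \<open>y \<in> S\<close> by (auto simp: S_def)
  qed
  have S_comm: "x \<otimes> y = y \<otimes> x" if xy: "x \<in> S" "y \<in> S" for x y
  proof -
    obtain i a b where *: "conj_by (t [^] (i::nat)) x = s [^] (a::int)" "conj_by (t [^] i) y = s [^] (b::int)"
      using S_common[OF xy] by blast
    have "conj_by (t [^] i) (x \<otimes> y) = conj_by (t [^] i) (y \<otimes> x)"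
      using xy t s * by (simp add: conj_by_mult S_def add.commute flip: int_pow_mult)
    then show ?thesis
      using xy t by (simp add: conj_by_inj S_def)
  qed
  have norm0: "conj_by (\<theta>0 k) x \<in> S" if "x \<in> S" for x k
  proof -
    obtain i j where ij: "x \<in> carrier G" "conj_by (t [^] (i::nat)) x = s [^] (j::int)"
      using \<open>x \<in> S\<close> by (auto simp: S_def)
    have "\<theta>0 k \<otimes> t [^] i = t [^] i \<otimes> \<theta>0 k"
      using group_commutes_pow[of t "\<theta>0 k" i] t t_comm closed0 by simp
    then have "conj_by (t [^] i) (conj_by (\<theta>0 k) x) = conj_by (\<theta>0 k) (s [^] j)"
      using ij t closed0 by (metis conj_by_by_mult nat_pow_closed)
    also have "\<dots> = s [^] j"
      using s closed0 by (simp add: conj_by_int_pow fix_s)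
    finally show ?thesis
      using ij closed0 by (auto simp: S_def)
  qed
  have norm_t: "conj_by (t [^] l) x \<in> S" if "x \<in> S" for x and l :: int
  proof -
    obtain i j where ij: "x \<in> carrier G" "conj_by (t [^] (i::nat)) x = s [^] (j::int)"
      using \<open>x \<in> S\<close> by (auto simp: S_def)
    \<comment> \<open>Chosen so that l + m = i + |l|; the conjugator t^m has a nonnegative exponent
      even if l is positive, as membership in S demands.\<close>
    define m where "m = nat (int i + \<bar>l\<bar> - l)"
    have "t [^] l \<otimes> t [^] m = t [^] (i + nat \<bar>l\<bar>)"
    proof -
      have "int m = int i + \<bar>l\<bar> - l"
        unfolding m_def by (rule nat_0_le) arith
      then show ?thesis
        using t by (simp flip: int_pow_mult int_pow_int)
    qed
    then have "conj_by (t [^] m) (conj_by (t [^] l) x) = conj_by (t [^] (i + nat \<bar>l\<bar>)) x"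
      using ij t by (simp flip: conj_by_by_mult)
    then show ?thesis
      using S_later[OF ij] ij t by (auto simp: S_def)
  qed
  \<comment> \<open>Elements of the image of \<open>\<theta>1\<close> commute with t, but t doubles
    exponents in S, so only the identity is common.\<close>
  have S_fix: "x = \<one>" if "x \<in> S" "x \<in> range \<theta>1" for x
  proof -
    have "x \<otimes> t = t \<otimes> x"
      using that \<open>t \<in> range \<theta>1\<close> homocyclic_commute[OF hc1] by auto
    obtain i j where ij: "x \<in> carrier G" "conj_by (t [^] (i::nat)) x = s [^] (j::int)"
      using \<open>x \<in> S\<close> by (auto simp: S_def)
    have fix_x: "conj_by (t [^] n) x = x" for n :: nat
      using \<open>x \<otimes> t = t \<otimes> x\<close> group_commutes_pow[of t x n] ij t by (simp add: conj_by_eq_self_iff)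
    have "s [^] (j * 2 ^ 1) = s [^] j"
      using S_later[OF ij, of 1] ij(2) unfolding fix_x by simp
    then have "j = 0" by (auto dest!: s_eq)
    then show "x = \<one>"
      using ij fix_x by simp
  qed
  have "s \<in> S"
    using s t by (auto simp: S_def intro!: exI[of _ "0::nat"] exI[of _ "1::int"])
  have "\<exists>t'\<in>carrier G. (\<forall>x\<in>S. conj_by t' x = x [^] (3::int)) \<and> (\<forall>x\<in>range \<theta>1. conj_by t' x = x)"
  proof (rule lift_power_map[OF S homocyclic_subgroup[OF hc1] S_comm])
    show "finite (A1 \<union> {s})" using A1 by simp
    show "A1 \<union> {s} \<subseteq> S \<union> range \<theta>1"
      using A1 \<open>s \<in> S\<close> by auto
    have sub: "subgroup (generate G (A1 \<union> {s})) G"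
      using s A1 closed1 by (intro generate_is_subgroup) auto
    have "range \<theta>1 \<subseteq> generate G (A1 \<union> {s})"
      unfolding A1(1)[symmetric] by (intro mono_generate) auto
    \<comment> \<open>Every element of S is a conjugate of a power of s by a power of t. This makes
      S T finitely generated although S is not.\<close>
    moreover have "x \<in> generate G (A1 \<union> {s})" if "x \<in> S" for x
    proof -
      obtain i j where ij: "x \<in> carrier G" "conj_by (t [^] (i::nat)) x = s [^] (j::int)"
        using \<open>x \<in> S\<close> by (auto simp: S_def)
      have "t \<in> generate G (A1 \<union> {s})" "s \<in> generate G (A1 \<union> {s})"
        using \<open>t \<in> range \<theta>1\<close> \<open>range \<theta>1 \<subseteq> _\<close> by (auto intro: generate.incl)
      then have "t [^] i \<in> generate G (A1 \<union> {s})" "s [^] j \<in> generate G (A1 \<union> {s})"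
        using subgroup_int_pow_closed[OF sub] by (auto simp flip: int_pow_int)
      then have "conj_by (inv (t [^] i)) (s [^] j) \<in> generate G (A1 \<union> {s})"
        using sub by (simp add: conj_by_def subgroup.m_closed subgroup.m_inv_closed)
      moreover have "x = conj_by (inv (t [^] i)) (s [^] j)"
        using ij t by (metis conj_by_inv_cancel(1) nat_pow_closed)
      ultimately show ?thesis by simp
    qed
    ultimately show "S \<union> range \<theta>1 \<subseteq> generate G (A1 \<union> {s})" by auto
    show "conj_by y x \<in> S" if "x \<in> S" "y \<in> range \<theta>1" for x y
      using that norm0 norm_t closed0 t subgroup.mem_carrier[OF S]
      by (auto simp: \<theta>1(2) conj_by_by_mult)
    show "x = \<one>" if "x \<in> S" "x [^] (3::int) = \<one>" for x
    proof -
      obtain i j where ij: "x \<in> carrier G" "conj_by (t [^] (i::nat)) x = s [^] (j::int)"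
        using \<open>x \<in> S\<close> by (auto simp: S_def)
      have "s [^] (j * 3) = conj_by (t [^] i) (x [^] (3::int))"
        using ij t s by (simp add: conj_by_int_pow int_pow_pow)
      also have "\<dots> = \<one>"
        using that t group_hom.hom_one[OF conj_by_hom] by simp
      finally have "j = 0" by (auto dest: s_one)
      then have "conj_by (t [^] i) x = conj_by (t [^] i) \<one>"
        using ij t group_hom.hom_one[OF conj_by_hom] by simp
      then show ?thesis
        using ij t by (simp add: conj_by_inj)
    qed
    show "x [^] (3::int) = x" if "x \<in> S" "x \<in> range \<theta>1" for x
      using S_fix[OF that] by simp
  qed
  then obtain t' where t': "t' \<in> carrier G" "conj_by t' s = s [^] (3::nat)"
    "\<And>k. conj_by t' (\<theta>1 k) = \<theta>1 k"
    using \<open>s \<in> S\<close> int_pow_int[of G s 3] by auto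
  have t'_pow: "conj_by (t' [^] (i::nat)) (s [^] (j::int)) = s [^] (j * 3 ^ i)" for i j
    using t' s conj_by_pow_power[OF t'(1) s t'(2), of i]
    by (simp add: conj_by_int_pow int_pow_pow mult.commute flip: int_pow_int)
  have "j = 0" if j: "t' [^] (j::int) \<in> range \<theta>1" for j
  proof -
    obtain k where k: "t' [^] j = \<theta>1 k" using j by (rule rangeE)
    have "t' [^] nat \<bar>j\<bar> = \<theta>1 (if j \<ge> 0 then k else (\<lambda>i. - k i))"
      using k t' closed1 by (auto simp: homocyclic_uminus[OF hc1] int_pow_neg simp flip: int_pow_int)
    then obtain l where l: "t' [^] nat \<bar>j\<bar> = \<theta>1 l" by blast
    have act0: "conj_by (\<theta>0 l) (s [^] (a::int)) = s [^] a" for a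
      using s closed0 by (simp add: conj_by_int_pow fix_s)
    show "j = 0"
    \<comment> \<open>Acting on s, the equation for t'^|j| equates 3^|j| with 2^(l n); for negative
      \<open>l n\<close> the power of t is moved to the other side.\<close>
    proof (cases "l n \<ge> 0")
      case True
      have "conj_by (t' [^] nat \<bar>j\<bar>) (s [^] (1::int)) = conj_by (t [^] nat (l n)) (conj_by (\<theta>0 l) (s [^] (1::int)))"
        using True l t s closed0 by (simp add: \<theta>1(2) pow_nat conj_by_by_mult del: int_pow_1)
      then have "s [^] ((1::int) * 3 ^ nat \<bar>j\<bar>) = s [^] ((1::int) * 2 ^ nat (l n))"
        unfolding t'_pow t_pow act0 .
      then have eq: "(3::int) ^ nat \<bar>j\<bar> = 2 ^ nat (l n)"
        by (auto dest!: s_eq)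
      have "odd ((3::int) ^ nat \<bar>j\<bar>)" by simp
      then have "nat (l n) = 0"
        unfolding eq by simp
      with eq show ?thesis by simp
    next
      case False
      have "t' [^] nat \<bar>j\<bar> \<otimes> t [^] nat (- l n) = \<theta>0 l"
        using False l t closed0 by (simp add: \<theta>1(2) m_assoc pow_nat flip: int_pow_mult)
      then have "conj_by (t [^] nat (- l n)) (conj_by (t' [^] nat \<bar>j\<bar>) (s [^] (1::int))) =
          conj_by (\<theta>0 l) (s [^] (1::int))"
        using t t' s by (simp flip: conj_by_by_mult del: int_pow_1)
      then have "s [^] ((1::int) * 3 ^ nat \<bar>j\<bar> * 2 ^ nat (- l n)) = s [^] (1::int)"
        unfolding t'_pow t_pow act0 .
      then have "(1::int) * 3 ^ nat \<bar>j\<bar> * 2 ^ nat (- l n) = 1"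
        by (rule s_eq)
      moreover have "(3::int) ^ nat \<bar>j\<bar> > 0" by simp
      ultimately show ?thesis
        by (auto simp: zmult_eq_1_iff)
    qed
  qed
  then have "homocyclic (Suc (Suc n)) 0 (\<lambda>k. \<theta>1 k \<otimes> t' [^] k (Suc n))"
    using t' closed1 by (intro homocyclic_extend[OF hc1]) (auto simp flip: conj_by_eq_self_iff)
  then show ?thesis by blast
qed

lemma homocyclic_infinite_order:
  assumes "g \<in> carrier G" "ord g = 0"
  shows "\<exists>\<theta>. homocyclic (Suc n) 0 \<theta>"
proof (induction n)
  case 0
  show ?case using homocyclic_cyclic[of g] assms by auto
next
  case (Suc n)
  then show ?case using homocyclic_zero_step by blast
qed

end

subsection \<open>Elements of unbounded prime power order\<close>

text \<open>For odd p the factor 2 is invertible, and for p = 2 it absorbs one power of p; the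
  weaker conclusion treats both alike.\<close>

lemma prime_power_dvd_double:
  assumes "prime (p::nat)" "int p ^ Suc e dvd 2 * k"
  shows "int p ^ e dvd k"
proof (cases "p = 2")
  case True
  then show ?thesis using assms(2) by simp
next
  case False
  then have "coprime (int p ^ Suc e) 2"
    using assms(1) primes_coprime[of p 2] by (simp flip: coprime_int_iff)
  then have "int p ^ Suc e dvd k"
    using assms(2) by (simp add: coprime_dvd_mult_right_iff)
  then show ?thesis
    by (meson dvd_trans le_imp_power_dvd lessI less_imp_le)
qed

text \<open>The binomial expansion to first order. It makes the action of u additive in the
  exponent: u^j acts on A as x^(1 + j q).\<close>

lemma one_plus_power_cong:
  "[(1 + a) ^ j = 1 + int j * a] (mod a ^ 2)" for a :: int
proof (induction j)
  case (Suc j)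
  have "[(1 + a) ^ Suc j = (1 + a) * (1 + int j * a)] (mod a ^ 2)"
    using cong_scalar_left[OF Suc.IH, of "1 + a"] by simp
  moreover have "(1 + a) * (1 + int j * a) = (1 + int (Suc j) * a) + int j * a ^ 2"
    by (simp add: algebra_simps power2_eq_square)
  ultimately show ?case
    by (simp add: cong_def)
qed simp

context group
begin

lemma subgroup_mult_cancel_left:
  assumes "subgroup H G" "a \<in> H" "b \<in> carrier G"
  shows "a \<otimes> b \<in> H \<longleftrightarrow> b \<in> H"
proof
  assume "a \<otimes> b \<in> H"
  then have "inv a \<otimes> (a \<otimes> b) \<in> H"
    using assms by (simp add: subgroup.m_closed subgroup.m_inv_closed)
  then show "b \<in> H"
    using assms by (simp add: mult_inv_cancel_left subgroup.mem_carrier)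
qed (use assms in \<open>simp add: subgroup.m_closed\<close>)

text \<open>The exponents j with u^j in A form a subgroup of the integers, nonzero because u has
  finite order; F is its positive generator.\<close>

lemma order_modulo_subgroup:
  assumes A: "subgroup A G" and u: "u \<in> carrier G" "ord u \<noteq> 0"
  obtains F :: nat where "F > 0" "\<And>j::int. u [^] j \<in> A \<longleftrightarrow> int F dvd j"
proof -
  define F where "F = (LEAST n::nat. n > 0 \<and> u [^] n \<in> A)"
  have "ord u > 0 \<and> u [^] ord u \<in> A"
    using u subgroup.one_closed[OF A] by simp
  then have F: "F > 0 \<and> u [^] F \<in> A"
    unfolding F_def by (rule LeastI)
  have F_min: "n = 0" if "n < F" "u [^] n \<in> A" for n
    using not_less_Least[of n "\<lambda>n. n > 0 \<and> u [^] n \<in> A"] that by (auto simp: F_def)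
  show ?thesis
  proof (rule that)
    show "F > 0" using F by simp
    fix j :: int
    define r where "r = nat (j mod int F)"
    have r: "j = int F * (j div int F) + int r" "r < F"
      using F by (simp_all add: r_def nat_less_iff)
    have FA: "(u [^] F) [^] (i::int) \<in> A" for i
      using F by (intro subgroup_int_pow_closed[OF A]) simp
    have "u [^] j = (u [^] F) [^] (j div int F) \<otimes> u [^] r"
      using u by (subst r(1)) (simp add: int_pow_mult int_pow_pow flip: int_pow_int)
    then have "u [^] j \<in> A \<longleftrightarrow> u [^] r \<in> A"
      using FA u subgroup_mult_cancel_left[OF A] by simp
    also have "\<dots> \<longleftrightarrow> r = 0"
      using F_min[of r] r(2) subgroup.one_closed[OF A] by auto
    also have "\<dots> \<longleftrightarrow> int F dvd j"
      using F by (auto simp: r_def dvd_eq_mod_eq_0 nat_eq_iff)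
    finally show "u [^] j \<in> A \<longleftrightarrow> int F dvd j" .
  qed
qed

end

context inner_ultrahomogeneous_group
begin

text \<open>Conjugation by \<open>u\<close> acts on the homocyclic group \<open>A\<close> of exponent \<open>q\<^sup>2\<close> as \<open>x \<mapsto> x\<^sup>1\<^sup>+\<^sup>q\<close> with
  \<open>q = p\<^bsup>e+1\<^esup>\<close>, so it centralises the \<open>q\<close>-th powers while having order \<open>q\<close> modulo the centraliser
  of \<open>A\<close>. Since \<open>u\<close> commutes with an element \<open>r\<close> inverting \<open>A\<close>, a power of \<open>u\<close> in \<open>A\<close> is an
  involution at most, and this is corrected by a factor in \<open>A\<close>.\<close>

lemma homocyclic_prime_power_step:
  assumes p: "prime (p::nat)" and torsion: "\<And>g. g \<in> carrier G \<Longrightarrow> ord g \<noteq> 0"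
    and hc: "homocyclic (Suc n) (int p ^ (2 * Suc e)) \<theta>"
  shows "\<exists>\<theta>'. homocyclic (Suc (Suc n)) (int p ^ e) \<theta>'"
proof -
  define q where "q = p ^ Suc e"
  define N where "N = q ^ 2"
  have N: "int p ^ (2 * Suc e) = int N"
    unfolding N_def q_def of_nat_power power_mult[symmetric] by (simp only: mult.commute)
  note hc = hc[unfolded N]
  have p2: "p \<ge> 2" using p by (rule prime_ge_2_nat)
  have q: "q \<ge> 2"
    using p2 self_le_power[of p "Suc e"] by (simp add: q_def del: power_Suc)
  have "N \<ge> q" by (simp add: N_def power2_eq_square)
  with q have N2: "N \<ge> 2" by simp
  note closed = homocyclic_closed[OF hc]
  define A where "A = range \<theta>"
  have A: "subgroup A G" unfolding A_def by (rule homocyclic_subgroup[OF hc])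
  have A_comm: "x \<otimes> y = y \<otimes> x" if "x \<in> A" "y \<in> A" for x y
    using that homocyclic_commute[OF hc] by (auto simp: A_def)
  have A_carr: "x \<in> carrier G" if "x \<in> A" for x
    using that closed by (auto simp: A_def)
  have A_one: "x [^] (int N * j) = \<one>" if "x \<in> A" for x j
    using that by (auto simp: A_def homocyclic_int_pow[OF hc] homocyclic_eq_one[OF hc])
  have A_pow: "x [^] (i::int) = x [^] j" if x: "x \<in> A" and ij: "[i = j] (mod int N)" for x i j
  proof -
    obtain l where "i = j + int N * l"
      using ij by (metis cong_iff_lin cong_sym)
    then show ?thesis
      using A_one[OF x, of l] A_carr[OF x] by (simp add: int_pow_mult)
  qed
  define B where "B = (\<lambda>j. \<theta> (\<lambda>i. of_bool (i = j))) ` {..<Suc n}"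
  have B: "finite B" "generate G B = A" "B \<subseteq> A"
    using homocyclic_generators[OF hc] unfolding A_def B_def by auto

  \<comment> \<open>On A, which has exponent N, the power N - 1 is inversion.\<close>
  have "\<exists>r\<in>carrier G. (\<forall>x\<in>A. conj_by r x = x [^] int (N - 1)) \<and> (\<forall>t\<in>{\<one>}. conj_by r t = t)"
  proof (rule lift_power_map[OF A triv_subgroup A_comm])
    show "conj_by t x \<in> A" if "x \<in> A" "t \<in> {\<one>}" for x t
      using that A_carr by simp
    show "x = \<one>" if "x \<in> A" "x [^] int (N - 1) = \<one>" for x
    proof -
      have "x [^] (int (N - 1) + 1) = x"
        using that A_carr by (simp add: int_pow_mult)
      then show ?thesis
        using A_one[OF that(1), of 1] N2 by simp
    qed
    show "finite B" "B \<subseteq> A \<union> {\<one>}" "A \<union> {\<one>} \<subseteq> generate G B"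
      using B subgroup.one_closed[OF A] by auto
  qed auto
  then obtain r where r: "r \<in> carrier G" "\<And>x. x \<in> A \<Longrightarrow> conj_by r x = x [^] (N - 1)"
    by (auto simp: int_pow_int)
  define T where "T = generate G {r}"
  have T: "subgroup T G"
    unfolding T_def using r by (intro generate_is_subgroup) simp
  have T_pow: "\<exists>n::nat. t = r [^] n" if "t \<in> T" for t
    using that generate_pow_nat[OF r(1) torsion[OF r(1)]] by (auto simp: T_def)
  have sq: "x [^] (2::int) = \<one>" if "x \<in> A" "x \<otimes> r = r \<otimes> x" for x
  proof -
    have "x = x [^] int (N - 1)"
      using that r A_carr by (simp add: int_pow_int flip: conj_by_eq_self_iff)
    then have "x [^] (1 + 1 :: int) = x [^] (int (N - 1) + 1)"
      using that A_carr by (metis int_pow_1 int_pow_mult)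
    also have "\<dots> = \<one>"
      using A_one[OF that(1), of 1] N2 by simp
    finally show ?thesis by simp
  qed
  \<comment> \<open>The exponent p^(2e+1) is N / p: dividing the congruence modulo N by 2 costs at
    most one factor p.\<close>
  have sq_root: "\<exists>l. x = \<theta> (\<lambda>i. int p ^ (2 * e + 1) * l i)" if x: "x \<in> A" "x [^] (2::int) = \<one>" for x
  proof -
    obtain k where k: "x = \<theta> k" using x by (auto simp: A_def)
    have "int p ^ (2 * e + 1) dvd k i" if "i < Suc n" for i
    proof (rule prime_power_dvd_double[OF p])
      have "int N dvd 2 * k i"
        using x(2) that by (simp add: k homocyclic_int_pow[OF hc] homocyclic_eq_one[OF hc])
      then show "int p ^ Suc (2 * e + 1) dvd 2 * k i"
        unfolding N[symmetric] by simp
    qed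
    then have "x = \<theta> (\<lambda>i. int p ^ (2 * e + 1) * (k i div int p ^ (2 * e + 1)))"
      by (simp add: k homocyclic_eq_iff[OF hc])
    then show ?thesis by (rule exI[of _ "\<lambda>i. k i div int p ^ (2 * e + 1)"])
  qed

  have "\<exists>u\<in>carrier G. (\<forall>x\<in>A. conj_by u x = x [^] int (1 + q)) \<and> (\<forall>t\<in>T. conj_by u t = t)"
  proof (rule lift_power_map[OF A T A_comm])
    show "conj_by t x \<in> A" if "x \<in> A" "t \<in> T" for x t
      using T_pow[OF that(2)] conj_by_pow_power[OF r(1) A_carr r(2)] that subgroup_int_pow_closed[OF A]
      by (auto simp flip: int_pow_int)
    show "x = \<one>" if "x \<in> A" "x [^] int (1 + q) = \<one>" for x
    proof -
      \<comment> \<open>The power 1 - q inverts the power 1 + q on A, as their product 1 - q^2 is 1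
        modulo N.\<close>
      have "x = x [^] (int (1 + q) * (1 - int q))"
      proof -
        have "[int (1 + q) * (1 - int q) = 1] (mod int N)"
          by (simp add: N_def cong_iff_dvd_diff algebra_simps power2_eq_square)
        then show ?thesis
          using A_pow[of x] that A_carr by simp
      qed
      also have "\<dots> = (x [^] int (1 + q)) [^] (1 - int q)"
        using A_carr[OF that(1)] by (rule int_pow_pow[symmetric])
      finally show ?thesis using that by simp
    qed
    show "x [^] int (1 + q) = x" if "x \<in> A" "x \<in> T" for x
    proof -
      obtain n :: nat where n: "x = r [^] n" using T_pow[OF \<open>x \<in> T\<close>] by blast
      have "x \<otimes> r = r \<otimes> x"
        using r(1) group_commutes_pow[of r r n] by (simp add: n)
      then obtain l where l: "x = \<theta> (\<lambda>i. int p ^ (2 * e + 1) * l i)"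
        using sq sq_root \<open>x \<in> A\<close> by blast
      have "int N dvd int q * (int p ^ (2 * e + 1) * l i)" for i
      proof -
        have "int q * (int p ^ (2 * e + 1) * l i) = int N * (int p ^ e * l i)"
          unfolding N[symmetric] q_def by (simp add: power_add power_mult power2_eq_square)
        then show ?thesis by (metis dvd_triv_left)
      qed
      then have "x [^] int q = \<one>"
        by (simp add: l homocyclic_int_pow[OF hc] homocyclic_eq_one[OF hc])
      then show ?thesis
        using A_carr[OF \<open>x \<in> A\<close>] by (simp add: int_pow_mult)
    qed
    show "finite (B \<union> {r})" using B by simp
    show "B \<union> {r} \<subseteq> A \<union> T"
      using B by (auto simp: T_def intro: generate.incl)
    show "A \<union> T \<subseteq> generate G (B \<union> {r})"
      unfolding T_def B(2)[symmetric] by (intro Un_least mono_generate) auto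
  qed
  then obtain u where u: "u \<in> carrier G" "\<And>x. x \<in> A \<Longrightarrow> conj_by u x = x [^] (1 + q)"
    "conj_by u r = r"
    using generate.incl[of r "{r}" G] by (auto simp: T_def int_pow_int simp del: of_nat_add of_nat_Suc)
  have u_pow: "conj_by (u [^] (j::nat)) x = x [^] (1 + int j * int q)" if "x \<in> A" for x j
  proof -
    have "conj_by (u [^] j) x = x [^] ((1 + int q) ^ j)"
      using conj_by_pow_power[OF u(1) A_carr u(2)] that by (simp flip: int_pow_int)
    also have "\<dots> = x [^] (1 + int j * int q)"
      using that one_plus_power_cong[of "int q" j] by (intro A_pow) (simp_all add: N_def)
    finally show ?thesis .
  qed
  obtain F where F: "F > 0" "\<And>j::int. u [^] j \<in> A \<longleftrightarrow> int F dvd j"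
    using order_modulo_subgroup[OF A u(1) torsion[OF u(1)]] by blast
  have uF: "u [^] F \<in> A" using F(2)[of "int F"] by (simp add: int_pow_int)
  \<comment> \<open>u^F lies in the abelian group A and so acts trivially on it, while it acts as
    x^(1 + F q); hence q^2 divides F q.\<close>
  have "q dvd F"
  proof -
    define x where "x = \<theta> (\<lambda>i. of_bool (i = 0))"
    have x: "x \<in> A" by (simp add: x_def A_def)
    have "x [^] (1 + int F * int q) = x [^] (1::int)"
      using u_pow[OF x, of F] A_comm[OF x uF] conj_by_eq_self_iff[OF A_carr[OF uF] A_carr[OF x]] A_carr[OF x]
      by simp
    then have "x [^] (int F * int q) = \<one>"
      using x A_carr by (simp add: int_pow_mult)
    then have "int N dvd int F * int q"
      by (auto simp: x_def homocyclic_int_pow[OF hc] homocyclic_eq_one[OF hc] dest: spec[of _ 0])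
    then show ?thesis
      using q by (simp add: N_def power2_eq_square flip: of_nat_mult)
  qed
  \<comment> \<open>Only p^e of the factor q = p^(e+1) is used. The element u^F is a p^(2e+1)-th
    power in A, so it has a p^e-th root w that is still a q-th power and hence centralised by u.
    This allows c1 to be corrected by the inverse of w; a q-th root would only be a p^e-th
    power.\<close>
  moreover have "p ^ e dvd q" by (simp add: q_def)
  ultimately obtain F' where F': "F = F' * p ^ e"
    by (metis dvd_trans dvd_def mult.commute)
  define c1 where "c1 = u [^] F'"
  have c1: "c1 \<in> carrier G" using u by (simp add: c1_def)
  have c1_A: "c1 [^] j \<in> A \<longleftrightarrow> int (p ^ e) dvd j" for j :: int
  proof -
    have "c1 [^] j = u [^] (int F' * j)"
      using u by (simp add: c1_def int_pow_pow flip: int_pow_int)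
    then show ?thesis
      using F by (simp add: F')
  qed
  have "u [^] F \<otimes> r = r \<otimes> u [^] F"
    using u(3) conj_by_eq_self_iff[OF u(1) r(1)] by (intro group_commutes_pow u r) simp
  then obtain l where l: "u [^] F = \<theta> (\<lambda>i. int p ^ (2 * e + 1) * l i)"
    using sq sq_root uF by blast
  define w where "w = \<theta> (\<lambda>i. int q * l i)"
  have w: "w \<in> carrier G" "w \<in> A" by (simp_all add: w_def closed A_def)
  have w_pow: "w [^] int (p ^ e) = u [^] F"
  proof -
    have "int (p ^ e) * (int q * k) = int p ^ (2 * e + 1) * k" for k
      by (simp add: q_def mult_2 power_add)
    then show ?thesis
      by (simp only: w_def l homocyclic_int_pow[OF hc])
  qed
  have u_fix: "conj_by (u [^] (j::nat)) (\<theta> (\<lambda>i. int q * k i)) = \<theta> (\<lambda>i. int q * k i)" for j k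
  proof -
    have "(1 + int j * int q) * (int q * k i) - int q * k i = int N * (int j * k i)" for i
      by (simp add: N_def algebra_simps power2_eq_square)
    then have "\<theta> (\<lambda>i. (1 + int j * int q) * (int q * k i)) = \<theta> (\<lambda>i. int q * k i)"
      by (simp add: homocyclic_eq_iff[OF hc])
    then show ?thesis
      by (simp add: u_pow A_def homocyclic_int_pow[OF hc])
  qed
  define c where "c = c1 \<otimes> inv w"
  have c1w: "c1 \<otimes> inv w = inv w \<otimes> c1"
  proof -
    have "conj_by c1 w = w"
      unfolding c1_def w_def by (rule u_fix)
    then have "conj_by c1 (inv w) = inv w"
      using c1 w group_hom.hom_inv[OF conj_by_hom] by simp
    then show ?thesis using c1 w by (simp add: conj_by_eq_self_iff)
  qed
  have c_pow: "c [^] j = c1 [^] j \<otimes> inv w [^] j" for j :: int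
    unfolding c_def by (rule int_pow_mult_distrib[OF c1w]) (simp_all add: c1 w)
  have "c [^] int (p ^ e) = \<one>"
  proof -
    have "c1 [^] int (p ^ e) = u [^] F"
      using u by (simp add: c1_def F' nat_pow_pow int_pow_int del: of_nat_power)
    then show ?thesis
      using w w_pow u by (simp add: c_pow int_pow_inv del: of_nat_power)
  qed
  \<comment> \<open>p^(e+2) is N / p^e, which leaves exponent p^e, and it is a multiple of q, so u
    centralises these powers.\<close>
  define \<theta>0 where "\<theta>0 k = \<theta> (\<lambda>i. int p ^ (e + 2) * k i)" for k
  have hc0: "homocyclic (Suc n) (int p ^ e) \<theta>0"
    unfolding \<theta>0_def[abs_def]
  proof (rule homocyclic_scale[OF hc])
    show "int N = int p ^ (e + 2) * int p ^ e"
      unfolding N[symmetric] by (simp add: mult_2 flip: power_add)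
  qed (use p2 in simp)
  have "\<theta>0 k \<otimes> c = c \<otimes> \<theta>0 k" for k
  proof -
    have "\<theta>0 k = \<theta> (\<lambda>i. int q * (int p * k i))"
      by (simp add: \<theta>0_def q_def ac_simps)
    then have "\<theta>0 k \<otimes> c1 = c1 \<otimes> \<theta>0 k"
      using u_fix c1 u closed by (simp add: c1_def flip: conj_by_eq_self_iff)
    moreover have "\<theta>0 k \<otimes> inv w = inv w \<otimes> \<theta>0 k"
      using w A_comm[of "\<theta>0 k" "inv w"] subgroup.m_inv_closed[OF A] by (simp add: \<theta>0_def A_def)
    ultimately show ?thesis
      using c1 w homocyclic_closed[OF hc0] unfolding c_def by (metis inv_closed m_assoc)
  qed
  moreover have "int p ^ e dvd j" if "c [^] j \<in> range \<theta>0" for j :: int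
  proof -
    have "c [^] j \<in> A" using that by (auto simp: \<theta>0_def A_def)
    moreover have "inv w [^] j \<in> A"
      using w A by (intro subgroup_int_pow_closed[OF A]) (simp add: subgroup.m_inv_closed)
    moreover have "c [^] j = inv w [^] j \<otimes> c1 [^] j"
      unfolding c_def c1w by (rule int_pow_mult_distrib[OF c1w[symmetric]]) (simp_all add: c1 w)
    ultimately have "c1 [^] j \<in> A"
      using subgroup_mult_cancel_left[OF A] c1 by simp
    then show ?thesis by (simp add: c1_A)
  qed
  moreover have "c \<in> carrier G" using c1 w by (simp add: c_def)
  ultimately have "homocyclic (Suc (Suc n)) (int p ^ e) (\<lambda>k. \<theta>0 k \<otimes> c [^] k (Suc n))"
    using \<open>c [^] int (p ^ e) = \<one>\<close> by (intro homocyclic_extend[OF hc0]) simp_all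
  then show ?thesis by blast
qed

text \<open>A step raises the rank by one but lowers the exponent from p^(2e+2) to p^e, so the
  induction on the rank keeps e arbitrary.\<close>

lemma homocyclic_prime_power:
  assumes p: "prime (p::nat)" and torsion: "\<And>g. g \<in> carrier G \<Longrightarrow> ord g \<noteq> 0"
    and orders: "\<And>e. \<exists>g\<in>carrier G. ord g = p ^ e"
  shows "\<exists>\<theta>. homocyclic (Suc n) (int p ^ e) \<theta>"
proof (induction n arbitrary: e)
  case 0
  obtain g where "g \<in> carrier G" "ord g = p ^ e" using orders by blast
  then show ?case using homocyclic_cyclic[of g] by auto
next
  case (Suc n)
  obtain \<theta> where "homocyclic (Suc n) (int p ^ (2 * Suc e)) \<theta>"
    using Suc[of "2 * Suc e"] by blast
  then show ?case using homocyclic_prime_power_step[OF p torsion] by blast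
qed

end

subsection \<open>Elements of large prime order\<close>

text \<open>M is the product of the powers q^(e q) over the primes q \<le> B. A number whose prime
  factors are all at most B and whose q-parts stay below these powers divides M.\<close>

lemma large_prime_factor:
  fixes B :: nat and e :: "nat \<Rightarrow> nat"
  obtains M where "M > 0"
    "\<And>n. \<not> n dvd M \<Longrightarrow> (\<And>q. prime q \<Longrightarrow> \<not> q ^ e q dvd n) \<Longrightarrow> \<exists>q. prime q \<and> q > B \<and> q dvd n"
proof
  define M where "M = (\<Prod>q | prime q \<and> q \<le> B. q ^ e q)"
  have fin: "finite {q. prime q \<and> q \<le> B}" by simp
  show "M > 0"
    unfolding M_def by (intro prod_pos) (auto simp: prime_gt_0_nat)
  fix n assume n: "\<not> n dvd M" and e: "\<And>q. prime q \<Longrightarrow> \<not> q ^ e q dvd n"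
  have "n \<noteq> 0" using e[OF two_is_prime_nat] by (rule contrapos_nn) simp
  show "\<exists>q. prime q \<and> q > B \<and> q dvd n"
  proof (rule ccontr)
    assume neg: "\<not> (\<exists>q. prime q \<and> q > B \<and> q dvd n)"
    have "n dvd M"
    proof (rule multiplicity_le_imp_dvd)
      fix q :: nat assume q: "prime q"
      show "multiplicity q n \<le> multiplicity q M"
      proof (cases "q \<le> B")
        case True
        have "multiplicity q n \<le> e q"
          using e[OF q] by (metis linorder_le_cases multiplicity_dvd')
        moreover have "q ^ e q dvd M"
          unfolding M_def using q True fin by (intro dvd_prodI) auto
        then have "e q \<le> multiplicity q M"
          using \<open>M > 0\<close> q by (intro multiplicity_geI) (auto dest: prime_gt_1_nat)
        ultimately show ?thesis by simp
      next
        case False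
        then have "\<not> q dvd n" using neg q by auto
        then show ?thesis by (simp add: not_dvd_imp_multiplicity_0)
      qed
    qed (use \<open>n \<noteq> 0\<close> in auto)
    with n show False by simp
  qed
qed

section \<open>Powers of prime order and finite abelian 2-groups\<close>

context group
begin

lemma square_mult_commute:
  assumes "x \<otimes> y = y \<otimes> x" "x \<in> carrier G" "y \<in> carrier G"
  shows "(x \<otimes> y) \<otimes> (x \<otimes> y) = (x \<otimes> x) \<otimes> (y \<otimes> y)"
proof -
  have "(x \<otimes> y) \<otimes> (x \<otimes> y) = x \<otimes> ((y \<otimes> x) \<otimes> y)"
    using assms(2,3) by (simp add: m_assoc)
  also have "\<dots> = (x \<otimes> x) \<otimes> (y \<otimes> y)"
    unfolding assms(1)[symmetric] using assms(2,3) by (simp add: m_assoc)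
  finally show ?thesis .
qed

lemma prime_order_power:
  assumes "g \<in> carrier G" "ord g \<noteq> 0" "prime (q::nat)" "q dvd ord g"
  shows "ord (g [^] (ord g div q)) = q"
proof -
  have "ord (g [^] (ord g div q)) = ord g div (ord g div q)"
    using assms by (intro ord_pow) (auto simp: dvd_div_eq_0_iff div_dvd_iff_mult prime_gt_0_nat)
  then show ?thesis
    using assms by auto
qed

text \<open>Squaring maps E onto a subgroup whose exponent divides 2^(e-1), and its fibres are
  translates of the set of solutions of x x = 1. Each halving of the exponent thus costs a factor of
  at most \<open>card V\<close>.\<close>

lemma card_le_power_of_card_involutions:
  assumes "subgroup E G" "finite E" "\<And>x y. x \<in> E \<Longrightarrow> y \<in> E \<Longrightarrow> x \<otimes> y = y \<otimes> x"
    and "finite V" "{x \<in> E. x \<otimes> x = \<one>} \<subseteq> V" "\<And>x. x \<in> E \<Longrightarrow> x [^] ((2::nat) ^ e) = \<one>"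
  shows "card E \<le> card V ^ e"
  using assms
proof (induction e arbitrary: E)
  case 0
  then have "E \<subseteq> {\<one>}" using subgroup.mem_carrier by fastforce
  then have "card E \<le> card {\<one>}" by (intro card_mono) auto
  then show ?case by simp
next
  case (Suc e)
  note comm = Suc.prems(3)
  interpret E: subgroup E G by fact
  define D where "D = (\<lambda>x. x \<otimes> x) ` E"
  have "D \<subseteq> E" by (auto simp: D_def)
  have "subgroup D G"
  proof (rule subgroupI)
    show "D \<subseteq> carrier G" by (auto simp: D_def)
    show "D \<noteq> {}" using E.one_closed unfolding D_def by blast
    fix a assume "a \<in> D"
    then obtain x where x: "x \<in> E" "a = x \<otimes> x" by (auto simp: D_def)
    then show "inv a \<in> D"
      by (auto simp: D_def inv_mult_group)
    fix b assume "b \<in> D"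
    then obtain y where y: "y \<in> E" "b = y \<otimes> y" by (auto simp: D_def)
    have "a \<otimes> b = (x \<otimes> y) \<otimes> (x \<otimes> y)"
      unfolding x y using x(1) y(1) comm[of x y] by (intro square_mult_commute[symmetric]) auto
    then show "a \<otimes> b \<in> D"
      using x y by (auto simp: D_def)
  qed
  moreover have "finite D" using Suc.prems by (simp add: D_def)
  moreover have "x \<otimes> y = y \<otimes> x" if "x \<in> D" "y \<in> D" for x y
    using that \<open>D \<subseteq> E\<close> comm by blast
  moreover have "{x \<in> D. x \<otimes> x = \<one>} \<subseteq> V"
    using Suc.prems(5) \<open>D \<subseteq> E\<close> by blast
  moreover have "x [^] ((2::nat) ^ e) = \<one>" if x: "x \<in> D" for x
  proof -
    obtain y where y: "y \<in> E" "x = y \<otimes> y" using x by (auto simp: D_def)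
    then have "x = y [^] (2::nat)" by (simp add: numeral_2_eq_2)
    then show ?thesis using y Suc.prems(6)[of y] by (simp add: nat_pow_pow)
  qed
  ultimately have "card D \<le> card V ^ e"
    by (intro Suc.IH Suc.prems(4))
  have fib: "card {x \<in> E. x \<otimes> x = d} \<le> card V" if d: "d \<in> D" for d
  proof -
    obtain y where y: "y \<in> E" "d = y \<otimes> y" using d by (auto simp: D_def)
    have "inj_on (\<lambda>x. x \<otimes> inv y) {x \<in> E. x \<otimes> x = d}"
      using y by (auto intro!: inj_onI)
    moreover have "(\<lambda>x. x \<otimes> inv y) ` {x \<in> E. x \<otimes> x = d} \<subseteq> V"
    proof safe
      fix x assume x: "x \<in> E" "d = x \<otimes> x"
      have "(x \<otimes> inv y) \<otimes> (x \<otimes> inv y) = (x \<otimes> x) \<otimes> (inv y \<otimes> inv y)"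
        using x(1) y(1) comm[of x "inv y"] by (intro square_mult_commute) auto
      also have "inv y \<otimes> inv y = inv (x \<otimes> x)"
        using x y by (simp flip: inv_mult_group)
      finally have "(x \<otimes> inv y) \<otimes> (x \<otimes> inv y) = \<one>" using x(1) by simp
      then show "x \<otimes> inv y \<in> V"
        using x(1) y(1) by (intro subsetD[OF Suc.prems(5)] CollectI conjI) auto
    qed
    ultimately show ?thesis
      using Suc.prems(4) by (rule card_inj_on_le)
  qed
  have "E = (\<Union>d\<in>D. {x \<in> E. x \<otimes> x = d})" by (auto simp: D_def)
  then have "card E \<le> (\<Sum>d\<in>D. card {x \<in> E. x \<otimes> x = d})"
    using card_UN_le[OF \<open>finite D\<close>, of "\<lambda>d. {x \<in> E. x \<otimes> x = d}"] by simp
  also have "\<dots> \<le> card D * card V"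
    using sum_bounded_above[of D _ "card V", OF fib] by simp
  also have "\<dots> \<le> card V ^ e * card V"
    using \<open>card D \<le> _\<close> by simp
  finally show ?case by (simp add: mult.commute)
qed

text \<open>V is a vector space over the field with two elements, and independent vectors are chosen
  one at a time. The bound 2^i on the image is carried along since it leaves a vector outside as
  long as i < n.\<close>

lemma homocyclic_elementary:
  assumes V: "subgroup V G" "\<And>x y. x \<in> V \<Longrightarrow> y \<in> V \<Longrightarrow> x \<otimes> y = y \<otimes> x"
    and inv: "\<And>x. x \<in> V \<Longrightarrow> x \<otimes> x = \<one>" and card: "2 ^ n \<le> card V"
  shows "i \<le> n \<Longrightarrow> \<exists>\<theta>. homocyclic i 2 \<theta> \<and> range \<theta> \<subseteq> V \<and> finite (range \<theta>) \<and> card (range \<theta>) \<le> 2 ^ i"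
proof (induction i)
  case 0
  show ?case
    using homocyclic_trivial subgroup.one_closed[OF V(1)] by (intro exI[of _ "\<lambda>_. \<one>"]) auto
next
  case (Suc i)
  then obtain \<theta> where \<theta>: "homocyclic i 2 \<theta>" "range \<theta> \<subseteq> V" "finite (range \<theta>)" "card (range \<theta>) \<le> 2 ^ i"
    by auto
  have "(2::nat) ^ i < 2 ^ n"
    using Suc.prems by (intro power_strict_increasing) auto
  with \<theta>(4) card have "card (range \<theta>) < card V" by linarith
  then obtain v where v: "v \<in> V" "v \<notin> range \<theta>"
    using \<theta>(2) by (metis less_irrefl subsetI subset_antisym)
  then have vc: "v \<in> carrier G" "v [^] (2::int) = \<one>"
    using inv subgroup.mem_carrier[OF V(1)] int_pow_mult[of v 1 1] by auto
  have v_pow: "v [^] j = (if even j then \<one> else v)" for j :: int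
  proof -
    have "v [^] (2 * (j div 2) + j mod 2) = v [^] (j mod 2)"
      using vc int_pow_pow[OF vc(1), of 2 "j div 2"] by (simp only: int_pow_mult) simp
    then show ?thesis
      using vc by (auto simp: parity_cases[of j] elim: evenE oddE)
  qed
  have "homocyclic (Suc i) 2 (\<lambda>k. \<theta> k \<otimes> v [^] k i)"
  proof (rule homocyclic_extend[OF \<theta>(1) vc(1) _ vc(2)])
    show "\<theta> k \<otimes> v = v \<otimes> \<theta> k" for k
      by (rule V(2)[OF subsetD[OF \<theta>(2) rangeI] v(1)])
    show "2 dvd j" if "v [^] j \<in> range \<theta>" for j :: int
      using that v(2) by (auto simp: v_pow split: if_splits)
  qed
  moreover have "v [^] j \<in> V" for j :: int
    using v(1) V(1) by (rule subgroup_int_pow_closed[rotated])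
  then have "range (\<lambda>k. \<theta> k \<otimes> v [^] k i) \<subseteq> V"
    using \<theta>(2) subgroup.m_closed[OF V(1)] by blast
  moreover have sub: "range (\<lambda>k. \<theta> k \<otimes> v [^] k i) \<subseteq> range \<theta> \<union> (\<lambda>x. x \<otimes> v) ` range \<theta>"
    using homocyclic_closed[OF \<theta>(1)] by (auto simp: v_pow)
  moreover have "card (range (\<lambda>k. \<theta> k \<otimes> v [^] k i)) \<le> 2 ^ Suc i"
  proof -
    have "card (range (\<lambda>k. \<theta> k \<otimes> v [^] k i)) \<le> card (range \<theta> \<union> (\<lambda>x. x \<otimes> v) ` range \<theta>)"
      using sub \<theta>(3) by (intro card_mono) auto
    also have "\<dots> \<le> card (range \<theta>) + card (range \<theta>)"
      using \<theta>(3) card_image_le[OF \<theta>(3), of "\<lambda>x. x \<otimes> v"] by (intro order_trans[OF card_Un_le]) simp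
    finally show ?thesis using \<theta>(4) by simp
  qed
  ultimately show ?case
    using \<theta>(3) by (intro exI[of _ "\<lambda>k. \<theta> k \<otimes> v [^] k i"]) (auto intro: finite_subset)
qed

end

context inner_ultrahomogeneous_group
begin

text \<open>If \<open>t\<close> centralises \<open>E\<close> and acts on an element \<open>s\<close> of prime order \<open>p\<close> as a primitive root, its
  order is a multiple of \<open>p - 1\<close>. Its 2-part enlarges \<open>E\<close>, and a power of it of large prime order
  replaces \<open>s\<close>.\<close>

lemma large_abelian_two_subgroup:
  assumes torsion: "\<And>g. g \<in> carrier G \<Longrightarrow> ord g \<noteq> 0"
    and bounded: "\<And>q g. prime (q::nat) \<Longrightarrow> g \<in> carrier G \<Longrightarrow> \<not> q ^ b q dvd ord g"
    and unbounded: "\<And>M. M > 0 \<Longrightarrow> \<exists>g\<in>carrier G. \<not> ord g dvd M"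
  shows "\<exists>E s. subgroup E G \<and> finite E \<and> (\<forall>x\<in>E. \<forall>y\<in>E. x \<otimes> y = y \<otimes> x) \<and>
    (\<forall>x\<in>E. \<exists>j. x [^] ((2::nat) ^ j) = \<one>) \<and> 2 ^ k \<le> card E \<and>
    s \<in> carrier G \<and> prime (ord s) \<and> ord s > B \<and> (\<forall>x\<in>E. x \<otimes> s = s \<otimes> x)"
proof (induction k arbitrary: B)
  case 0
  obtain M where M: "M > 0"
    "\<And>n. \<not> n dvd M \<Longrightarrow> (\<And>q. prime q \<Longrightarrow> \<not> q ^ b q dvd n) \<Longrightarrow> \<exists>q. prime q \<and> q > B \<and> q dvd n"
    using large_prime_factor[of b B] by metis
  then obtain g where g: "g \<in> carrier G" "\<not> ord g dvd M"
    using unbounded by blast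
  then obtain q where q: "prime q" "q > B" "q dvd ord g"
    using M(2) bounded by blast
  then show ?case
    using g(1) prime_order_power[OF g(1) torsion[OF g(1)] q(1,3)]
    by (intro exI[of _ "{\<one>}"] exI[of _ "g [^] (ord g div q)"]) (simp add: triv_subgroup)
next
  case (Suc k)
  obtain M where M: "M > 0"
    "\<And>n. \<not> n dvd M \<Longrightarrow> (\<And>q. prime q \<Longrightarrow> \<not> q ^ b q dvd n) \<Longrightarrow> \<exists>q. prime q \<and> q > B \<and> q dvd n"
    using large_prime_factor[of b B] by metis
  \<comment> \<open>The bound M + 2 makes p odd and p - 1 larger than M. As p - 1 will divide the
    order n of t, this n does not divide M and has a prime factor above B.\<close>
  obtain E s where E: "subgroup E G" "finite E" "\<And>x y. x \<in> E \<Longrightarrow> y \<in> E \<Longrightarrow> x \<otimes> y = y \<otimes> x"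
      "\<And>x. x \<in> E \<Longrightarrow> \<exists>j. x [^] ((2::nat) ^ j) = \<one>" "2 ^ k \<le> card E"
    and s: "s \<in> carrier G" "prime (ord s)" "ord s > M + 2" "\<And>x. x \<in> E \<Longrightarrow> x \<otimes> s = s \<otimes> x"
    using Suc[of "M + 2"] by blast
  interpret E: subgroup E G by fact
  define p where "p = ord s"
  have p: "prime p" "p > M + 2" "odd p"
    using s prime_odd_nat[of "ord s"] by (auto simp: p_def)
  obtain l where "residue_primroot p l"
    using prime_primitive_root_exists[of p] p(1) prime_gt_1_nat by blast
  then have l: "coprime p l" "Pocklington.ord p l = p - 1"
    using p(1) by (simp_all add: residue_primroot_def totient_prime)
  have sub_s: "subgroup (generate G {s}) G"
    using s by (intro generate_is_subgroup) simp
  have gen_s: "\<exists>j::int. x = s [^] j" if "x \<in> generate G {s}" for x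
    using that generate_pow[OF s(1)] by auto
  have s_one: "s [^] j = \<one> \<longleftrightarrow> int p dvd j" for j :: int
    using s(1) by (simp add: int_pow_eq_id p_def)
  have E_gen: "generate G E = E"
    using E.is_subgroup by (metis generateI order_refl)
  have s_E: "x [^] (j::int) \<otimes> y = y \<otimes> x [^] j" if "x = s" "y \<in> E" for x j y
  proof -
    have "conj_by y s = s"
      using s(4)[OF that(2)] that s(1) conj_by_eq_self_iff[of y s] by simp
    then have "conj_by y (s [^] j) = s [^] j"
      using that s(1) by (simp add: conj_by_int_pow)
    then show ?thesis
      using that s by (simp add: conj_by_eq_self_iff)
  qed
  have "\<exists>t\<in>carrier G. (\<forall>x\<in>generate G {s}. conj_by t x = x [^] int l) \<and> (\<forall>x\<in>E. conj_by t x = x)"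
  proof (rule lift_power_map[OF sub_s E(1)])
    show "finite ({s} \<union> E)" using E(2) by simp
    show "{s} \<union> E \<subseteq> generate G {s} \<union> E" by (auto intro: generate.incl)
    have "generate G {s} \<union> generate G E \<subseteq> generate G ({s} \<union> E)"
      by (intro Un_least mono_generate) auto
    then show "generate G {s} \<union> E \<subseteq> generate G ({s} \<union> E)" by (simp only: E_gen)
    fix x assume "x \<in> generate G {s}"
    then obtain j :: int where j: "x = s [^] j" using gen_s by blast
    show "x = \<one>" if "x [^] int l = \<one>"
      using that l(1) s(1)
      by (simp add: j int_pow_pow s_one coprime_dvd_mult_left_iff)
    show "x \<otimes> y = y \<otimes> x" if y: "y \<in> generate G {s}" for y
    proof -
      obtain i :: int where "y = s [^] i" using y gen_s by blast
      then show ?thesis using s(1) by (simp add: j add.commute flip: int_pow_mult)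
    qed
    show "conj_by y x \<in> generate G {s}" if "y \<in> E" for y
      using s_E[OF refl that, of j] \<open>x \<in> generate G {s}\<close> that s(1)
        conj_by_eq_self_iff[of y "s [^] j"] by (simp add: j)
    \<comment> \<open>The intersection is trivial: elements of E have 2-power order, and p is
      odd.\<close>
    show "x [^] int l = x" if x: "x \<in> E"
    proof -
      obtain i where "x [^] ((2::nat) ^ i) = \<one>" using E(4)[OF x] by blast
      then have "int p dvd j * 2 ^ i"
        using s(1) by (simp add: j int_pow_pow s_one flip: int_pow_int)
      moreover have "coprime (int p) (2 ^ i)"
        using p(3) by (simp add: coprime_right_2_iff_odd)
      ultimately have "x = \<one>"
        by (simp add: j s_one coprime_dvd_mult_left_iff)
      then show ?thesis by simp
    qed
  qed
  then obtain t where t: "t \<in> carrier G" "conj_by t s = s [^] l" "\<And>x. x \<in> E \<Longrightarrow> conj_by t x = x"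
    using generate.incl[of s "{s}" G] by (auto simp: int_pow_int)
  \<comment> \<open>t^i raises s to the power l^i, and l has order p - 1 modulo p.\<close>
  have t_s: "s \<otimes> t [^] i = t [^] i \<otimes> s \<longleftrightarrow> p - 1 dvd i" for i :: nat
  proof -
    have "s \<otimes> t [^] i = t [^] i \<otimes> s \<longleftrightarrow> s [^] int (l ^ i) = s [^] (1::int)"
      using conj_by_pow_power[OF t(1) s(1) t(2), of i] conj_by_eq_self_iff[of "t [^] i" s] t(1) s(1)
      by (simp only: int_pow_int int_pow_1 nat_pow_closed)
    also have "\<dots> \<longleftrightarrow> [1 = int (l ^ i)] (mod int p)"
      using s(1) by (simp only: int_pow_eq cong_iff_dvd_diff p_def)
    also have "\<dots> \<longleftrightarrow> [l ^ i = 1] (mod p)"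
      by (metis cong_int_iff cong_sym_eq of_nat_1)
    finally show ?thesis unfolding ord_divides l(2) .
  qed
  have t_E: "x \<otimes> t [^] i = t [^] i \<otimes> x" if "x \<in> E" for x and i :: nat
    using that t group_commutes_pow[of t x i] by (simp add: conj_by_eq_self_iff)
  define n where "n = ord t"
  have n: "n > 0" using torsion[OF t(1)] by (simp add: n_def)
  have "p - 1 dvd n"
    using t_s[of n] t(1) s(1) by (simp add: n_def)
  then have "p - 1 \<le> n" using n by (rule dvd_imp_le)
  then have "\<not> n dvd M"
    using p(2) M(1) by (auto dest: dvd_imp_le)
  then obtain q where q: "prime q" "q > B" "q dvd n"
    using M(2)[of n] bounded t(1) by (auto simp: n_def)
  obtain a c where ac: "n = 2 ^ a * c" "odd c"
    using multiplicity_decompose'[of n 2] n by (metis nat_neq_iff prime_elem_not_unit two_is_prime_nat prime_elem_nat_iff)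
  \<comment> \<open>A generator of the 2-part of the cyclic group of t. It does not commute with s,
    since the even number p - 1 does not divide the odd number c, and so it lies outside E.\<close>
  define r where "r = t [^] c"
  have r: "r \<in> carrier G" using t by (simp add: r_def)
  have r_one: "r [^] ((2::nat) ^ a) = \<one>"
    using t(1) by (simp add: r_def nat_pow_pow mult.commute[of c] flip: ac(1)) (simp add: n_def)
  have "\<not> p - 1 dvd c"
  proof
    assume "p - 1 dvd c"
    moreover have "even (p - 1)" using p(3) by simp
    ultimately show False using ac(2) dvd_trans by blast
  qed
  then have "r \<notin> E"
    using t_s[of c] s(4)[of r] by (auto simp: r_def)
  have r_E: "x \<otimes> r [^] (i::nat) = r [^] i \<otimes> x" if "x \<in> E" for x i
    using t_E[OF that] t(1) by (simp add: r_def nat_pow_pow)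
  define D where "D = (\<lambda>(x, i::nat). x \<otimes> r [^] i) ` (E \<times> UNIV)"
  have DI: "x \<otimes> r [^] i \<in> D" if "x \<in> E" for x and i :: nat
    using that by (force simp: D_def)
  have DE: thesis if "y \<in> D" "\<And>x i. y = x \<otimes> r [^] (i::nat) \<Longrightarrow> x \<in> E \<Longrightarrow> thesis" for y thesis
    using that by (auto simp: D_def)
  have r_mod: "r [^] i = r [^] (i mod 2 ^ a)" for i :: nat
  proof -
    have "r [^] i = (r [^] ((2::nat) ^ a)) [^] (i div 2 ^ a) \<otimes> r [^] (i mod 2 ^ a)"
      using r by (simp only: nat_pow_pow nat_pow_mult mult_div_mod_eq)
    then show ?thesis using r by (simp add: r_one)
  qed
  have D_mult: "(x \<otimes> r [^] i) \<otimes> (y \<otimes> r [^] j) = (x \<otimes> y) \<otimes> r [^] (i + j)"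
    if "x \<in> E" "y \<in> E" for x y and i j :: nat
  proof -
    have "(x \<otimes> r [^] i) \<otimes> (y \<otimes> r [^] j) = x \<otimes> ((r [^] i \<otimes> y) \<otimes> r [^] j)"
      using that r by (simp add: m_assoc)
    also have "\<dots> = (x \<otimes> y) \<otimes> (r [^] i \<otimes> r [^] j)"
      unfolding r_E[OF that(2), symmetric] using that r by (simp add: m_assoc)
    finally show ?thesis using r by (simp add: nat_pow_mult)
  qed
  have "finite D"
  proof -
    have "D \<subseteq> (\<lambda>(x, i::nat). x \<otimes> r [^] i) ` (E \<times> {..<2 ^ a})"
    proof
      fix y assume "y \<in> D"
      then obtain x i where y: "y = x \<otimes> r [^] (i::nat)" "x \<in> E" by (rule DE)
      then have "y = x \<otimes> r [^] (i mod 2 ^ a)" by (simp flip: r_mod)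
      with y(2) show "y \<in> (\<lambda>(x, i::nat). x \<otimes> r [^] i) ` (E \<times> {..<2 ^ a})"
        by (intro image_eqI[of _ _ "(x, i mod 2 ^ a)"]) auto
    qed
    then show ?thesis
      by (rule finite_subset) (use E(2) in simp)
  qed
  moreover have "subgroup D G"
  proof (rule subgroupI)
    show "D \<subseteq> carrier G" using r by (auto simp: D_def)
    show "D \<noteq> {}" using DI[OF E.one_closed] by blast
    fix y assume "y \<in> D"
    then obtain x i where y: "y = x \<otimes> r [^] (i::nat)" "x \<in> E" by (rule DE)
    have "(inv x \<otimes> r [^] (2 ^ a * i - i)) \<otimes> y = (inv x \<otimes> x) \<otimes> r [^] (2 ^ a * i)"
      using y(2) by (simp add: y(1) D_mult del: l_inv Units_l_inv)
    also have "\<dots> = \<one>"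
      using y(2) r by (simp add: r_one flip: nat_pow_pow)
    finally have "inv y = inv x \<otimes> r [^] (2 ^ a * i - i)"
      using y r by (intro inv_equality) auto
    then show "inv y \<in> D" using y(2) by (simp add: DI)
    fix z assume "z \<in> D"
    then obtain w j where "z = w \<otimes> r [^] (j::nat)" "w \<in> E" by (rule DE)
    then show "y \<otimes> z \<in> D" using y by (simp add: D_mult DI)
  qed
  moreover have "y \<otimes> z = z \<otimes> y" if yz: "y \<in> D" "z \<in> D" for y z
  proof -
    obtain x i where y: "y = x \<otimes> r [^] (i::nat)" "x \<in> E" using yz(1) by (rule DE)
    obtain w j where "z = w \<otimes> r [^] (j::nat)" "w \<in> E" using yz(2) by (rule DE)
    then show ?thesis using y E(3)[of x w] by (simp add: D_mult add.commute)
  qed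
  moreover have "\<exists>j. y [^] ((2::nat) ^ j) = \<one>" if yD: "y \<in> D" for y
  proof -
    obtain x i where y: "y = x \<otimes> r [^] (i::nat)" "x \<in> E" using yD by (rule DE)
    obtain j where j: "x [^] ((2::nat) ^ j) = \<one>" using E(4)[OF y(2)] by blast
    have "y [^] ((2::nat) ^ (j + a)) = x [^] ((2::nat) ^ (j + a)) \<otimes> (r [^] i) [^] ((2::nat) ^ (j + a))"
      unfolding y(1) using r_E[OF y(2), of i] y(2) r by (intro pow_mult_distrib) auto
    also have "x [^] ((2::nat) ^ (j + a)) = (x [^] ((2::nat) ^ j)) [^] ((2::nat) ^ a)"
      using y(2) by (simp add: nat_pow_pow power_add)
    also have "(r [^] i) [^] ((2::nat) ^ (j + a)) = (r [^] ((2::nat) ^ a)) [^] (i * 2 ^ j)"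
      using r by (simp add: nat_pow_pow power_add ac_simps)
    finally show ?thesis using j r_one by (intro exI[of _ "j + a"]) simp
  qed
  moreover have "2 ^ Suc k \<le> card D"
  proof -
    have r1: "r [^] (1::nat) = r" using r by simp
    have "(\<lambda>x. x \<otimes> r) ` E \<inter> E = {}"
      using \<open>r \<notin> E\<close> r subgroup_mult_cancel_left[OF E(1)] by auto
    then have "card (E \<union> (\<lambda>x. x \<otimes> r) ` E) = card E + card ((\<lambda>x. x \<otimes> r) ` E)"
      using E(2) by (intro card_Un_disjoint) auto
    also have "card ((\<lambda>x. x \<otimes> r) ` E) = card E"
      using r by (intro card_image inj_onI) auto
    finally have "card (E \<union> (\<lambda>x. x \<otimes> r) ` E) = 2 * card E" by simp
    moreover have "x \<in> D" "x \<otimes> r \<in> D" if "x \<in> E" for x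
      using DI[OF that, of 0] DI[OF that, of 1] r1 that by (simp_all del: nat_pow_Suc One_nat_def)
    then have "card (E \<union> (\<lambda>x. x \<otimes> r) ` E) \<le> card D"
      using \<open>finite D\<close> by (intro card_mono) auto
    ultimately show ?thesis using E(5) by simp
  qed
  moreover have "ord (t [^] (n div q)) = q"
    unfolding n_def using q t(1) torsion by (intro prime_order_power) (auto simp: n_def)
  moreover have "y \<otimes> t [^] (n div q) = t [^] (n div q) \<otimes> y" if yD: "y \<in> D" for y
  proof -
    obtain x i where y: "y = x \<otimes> r [^] (i::nat)" "x \<in> E" using yD by (rule DE)
    have "y = x \<otimes> t [^] (c * i)"
      using t(1) by (simp add: y(1) r_def nat_pow_pow)
    moreover have "t [^] (c * i) \<otimes> t [^] (n div q) = t [^] (n div q) \<otimes> t [^] (c * i)"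
      using t(1) by (simp add: nat_pow_comm)
    moreover have "x \<otimes> a \<otimes> d = d \<otimes> (x \<otimes> a)" if "x \<otimes> d = d \<otimes> x" "a \<otimes> d = d \<otimes> a"
      "x \<in> carrier G" "a \<in> carrier G" "d \<in> carrier G" for x a d
      using that by (simp add: m_assoc) (simp flip: m_assoc)
    ultimately show ?thesis
      using t_E[OF y(2), of "n div q"] y(2) t(1) by simp
  qed
  ultimately show ?case
    using q t(1) by (intro exI[of _ D] exI[of _ "t [^] (n div q)"]) auto
qed

text \<open>The bound for the prime 2 gives E an exponent dividing 2^(b 2). Asking for 2^(n * b 2)
  elements of E therefore leaves at least 2^n solutions of x x = 1.\<close>

lemma homocyclic_bounded_prime_powers:
  assumes torsion: "\<And>g. g \<in> carrier G \<Longrightarrow> ord g \<noteq> 0"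
    and bounded: "\<And>q g. prime (q::nat) \<Longrightarrow> g \<in> carrier G \<Longrightarrow> \<not> q ^ b q dvd ord g"
    and unbounded: "\<And>M. M > 0 \<Longrightarrow> \<exists>g\<in>carrier G. \<not> ord g dvd M"
  shows "\<exists>\<theta>. homocyclic n 2 \<theta>"
proof -
  obtain E where E: "subgroup E G" "finite E" "\<And>x y. x \<in> E \<Longrightarrow> y \<in> E \<Longrightarrow> x \<otimes> y = y \<otimes> x"
      "\<And>x. x \<in> E \<Longrightarrow> \<exists>j. x [^] ((2::nat) ^ j) = \<one>" "2 ^ (n * b 2) \<le> card E"
    using large_abelian_two_subgroup[of b "n * b 2" 0, OF torsion bounded unbounded] by metis
  interpret E: subgroup E G by fact
  define V where "V = {x \<in> E. x \<otimes> x = \<one>}"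
  have V: "subgroup V G"
  proof (rule subgroupI)
    show "V \<subseteq> carrier G" by (auto simp: V_def)
    have "\<one> \<in> V" by (simp add: V_def)
    then show "V \<noteq> {}" by blast
    fix x assume x: "x \<in> V"
    then show "inv x \<in> V" by (auto simp: V_def simp flip: inv_mult_group)
    fix y assume y: "y \<in> V"
    have "(x \<otimes> y) \<otimes> (x \<otimes> y) = (x \<otimes> x) \<otimes> (y \<otimes> y)"
      using x y E(3)[of x y] by (intro square_mult_commute) (auto simp: V_def)
    then show "x \<otimes> y \<in> V" using x y by (auto simp: V_def)
  qed
  have "x [^] ((2::nat) ^ b 2) = \<one>" if x: "x \<in> E" for x
  proof -
    obtain j where "x [^] ((2::nat) ^ j) = \<one>" using E(4)[OF x] by blast
    then have "ord x dvd 2 ^ j" using x by (simp add: pow_eq_id)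
    then obtain i where i: "ord x = 2 ^ i"
      using divides_primepow_nat[OF two_is_prime_nat] by blast
    have "\<not> 2 ^ b 2 dvd (2::nat) ^ i"
      using bounded[OF two_is_prime_nat, of x] x by (simp add: i)
    then have "i \<le> b 2" by (meson le_imp_power_dvd nat_le_linear)
    then show ?thesis using x by (simp add: pow_eq_id i le_imp_power_dvd)
  qed
  then have "card E \<le> card V ^ b 2"
    using E(2,3) by (intro card_le_power_of_card_involutions[OF E(1)]) (auto simp: V_def)
  with E(5) have le: "(2 ^ n) ^ b 2 \<le> card V ^ b 2"
    by (simp add: power_mult)
  have "b 2 \<noteq> 0"
    using bounded[OF two_is_prime_nat one_closed] by (intro notI) simp
  with le have "2 ^ n \<le> card V"
    by (metis not_le power_strict_mono zero_le neq0_conv)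
  moreover have "x \<otimes> y = y \<otimes> x" if "x \<in> V" "y \<in> V" for x y
    using that E(3) by (simp add: V_def)
  moreover have "x \<otimes> x = \<one>" if "x \<in> V" for x
    using that by (simp add: V_def)
  ultimately have "\<exists>\<theta>. homocyclic n 2 \<theta> \<and> range \<theta> \<subseteq> V \<and> finite (range \<theta>) \<and> card (range \<theta>) \<le> 2 ^ n"
    using homocyclic_elementary[OF V, of n n] by simp
  then show ?thesis by blast
qed

section \<open>The three cases for the orders of elements\<close>

theorem homocyclic_arbitrary_rank:
  assumes "infinite_exponent G"
  obtains m \<theta> where "\<not> m dvd 1" "homocyclic (Suc n) m \<theta>"
proof -
  consider g where "g \<in> carrier G" "ord g = 0"
    | p where "\<And>g. g \<in> carrier G \<Longrightarrow> ord g \<noteq> 0" "prime (p::nat)" "\<And>e. \<exists>g\<in>carrier G. ord g = p ^ e"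
    | b where "\<And>g. g \<in> carrier G \<Longrightarrow> ord g \<noteq> 0" "\<And>q g. prime (q::nat) \<Longrightarrow> g \<in> carrier G \<Longrightarrow> ord g \<noteq> q ^ b q"
  proof (cases "(\<exists>g\<in>carrier G. ord g = 0) \<or> (\<exists>p. prime p \<and> (\<forall>e. \<exists>g\<in>carrier G. ord g = p ^ e))")
    case True
    then show ?thesis using that(1,2) by blast
  next
    case False
    then have "\<forall>q. \<exists>e. prime q \<longrightarrow> (\<forall>g\<in>carrier G. ord g \<noteq> q ^ e)" by blast
    then obtain b where "\<forall>q. prime q \<longrightarrow> (\<forall>g\<in>carrier G. ord g \<noteq> q ^ b q)"
      by (rule choice[THEN exE])
    then have "ord g \<noteq> q ^ b q" if "prime q" "g \<in> carrier G" for q g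
      using that by auto
    moreover have "ord g \<noteq> 0" if "g \<in> carrier G" for g
      using that False by auto
    ultimately show ?thesis by (intro that(3)[of b])
  qed
  then show thesis
  proof cases
    case 1
    then show ?thesis using homocyclic_infinite_order[of g n] that[of 0] by auto
  next
    case 2
    have "\<not> int p ^ 1 dvd 1" using 2(2) prime_gt_1_nat[of p] by simp
    then show ?thesis using homocyclic_prime_power[OF 2(2,1,3), of n 1] that by blast
  next
    case 3
    \<comment> \<open>An element whose order is a multiple of q^(b q) has a power of order exactly
      q^(b q).\<close>
    have bounded: "\<not> q ^ b q dvd ord g" if "prime (q::nat)" "g \<in> carrier G" for q g
    proof
      assume "q ^ b q dvd ord g"
      then obtain c where c: "ord g = c * q ^ b q" by (metis dvd_def mult.commute)
      have "c \<noteq> 0" using 3(1)[OF that(2)] c by auto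
      then have "ord (g [^] c) = q ^ b q"
        using that c prime_gt_0_nat[of q] by (subst ord_pow) auto
      then show False using 3(2)[OF that(1), of "g [^] c"] that(2) by simp
    qed
    have "\<exists>g\<in>carrier G. \<not> ord g dvd M" if "M > 0" for M
    proof -
      have "\<not> (\<forall>g\<in>carrier G. g [^] M = \<one>)"
        using assms that unfolding infinite_exponent_def by blast
      then show ?thesis by (simp add: pow_eq_id)
    qed
    then show ?thesis
      using homocyclic_bounded_prime_powers[of b "Suc n", OF 3(1) bounded] that[of 2] by auto
  qed
qed

end

subsection \<open>A countable elementary substructure\<close>

instance tm :: countable by countable_datatype
instance fm :: countable by countable_datatype

text \<open>Closed terms over countably many constants, with a Skolem function for each formula and
  variable; the list supplies the values of the variables 0, 1, ... Countability of this type bounds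
  the substructure.\<close>

datatype skolem = Base nat | Witness fm nat "skolem list"

instance skolem :: countable by countable_datatype

lemma finite_fv_tm: "finite (fv_tm t)"
  by (induction t) auto

lemma finite_fv: "finite (fv p)"
  by (induction p) (auto simp: finite_fv_tm)

lemma val_cong: "(\<And>v. v \<in> fv_tm t \<Longrightarrow> s v = s' v) \<Longrightarrow> val M s t = val M s' t"
  by (induction t) auto

lemma sat_cong: "(\<And>v. v \<in> fv p \<Longrightarrow> s v = s' v) \<Longrightarrow> sat M s p \<longleftrightarrow> sat M s' p"
proof (induction p arbitrary: s s')
  case (Eq t u)
  then show ?case using val_cong[of t s s' M] val_cong[of u s s' M] by auto
next
  case (Neg p)
  have "sat M s p \<longleftrightarrow> sat M s' p"
    by (rule Neg.IH) (simp add: Neg.prems)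
  then show ?case by simp
next
  case (Conj p q)
  have "sat M s p \<longleftrightarrow> sat M s' p" "sat M s q \<longleftrightarrow> sat M s' q"
    by (rule Conj.IH(1), simp add: Conj.prems) (rule Conj.IH(2), simp add: Conj.prems)
  then show ?case by simp
next
  case (All v p)
  have "sat M (s(v := a)) p \<longleftrightarrow> sat M (s'(v := a)) p" for a
    by (rule All.IH) (simp add: All.prems)
  then show ?case by simp
qed

text \<open>The Tarski-Vaught test for \<open>range e\<close>. Satisfaction is always evaluated in
  \<open>M\<close>, so \<open>range e\<close> is never made a structure of its own.\<close>

definition tarski_vaught :: "('a, 'b) monoid_scheme \<Rightarrow> (nat \<Rightarrow> 'a) \<Rightarrow> bool" where
  "tarski_vaught M e \<longleftrightarrow> range e \<subseteq> carrier M \<and>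
     (\<forall>s p v. (\<forall>w. s w \<in> range e) \<longrightarrow> (\<exists>x\<in>carrier M. sat M (s(v := x)) p) \<longrightarrow>
        (\<exists>k. sat M (s(v := e k)) p))"

lemma countable_elementary_substructure:
  assumes "countable X" "X \<subseteq> carrier M" "X \<noteq> {}"
  obtains e :: "nat \<Rightarrow> 'a" where "X \<subseteq> range e" "tarski_vaught M e"
proof -
  define asg where "asg as w = (if w < length as then as ! w else \<one>\<^bsub>M\<^esub>)" for as :: "'a list" and w
  \<comment> \<open>Membership in the carrier is part of the choice, so Skolem terms have values
    there even when the formula has no witness.\<close>
  define wit where "wit p v as = (SOME x. x \<in> carrier M \<and>
    ((\<exists>y\<in>carrier M. sat M ((asg as)(v := y)) p) \<longrightarrow> sat M ((asg as)(v := x)) p))" for p v as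
  define ev where "ev = rec_skolem (from_nat_into X) (\<lambda>p v ts. wit p v (map snd ts))"
  have ev: "ev (Base n) = from_nat_into X n" "ev (Witness p v ts) = wit p v (map ev ts)" for n p v ts
    by (simp_all add: ev_def comp_def)
  obtain x0 where x0: "x0 \<in> carrier M" using assms by blast
  have wit: "wit p v as \<in> carrier M \<and>
    ((\<exists>y\<in>carrier M. sat M ((asg as)(v := y)) p) \<longrightarrow> sat M ((asg as)(v := wit p v as)) p)" for p v as
    unfolding wit_def
  proof (rule someI_ex)
    show "\<exists>x. x \<in> carrier M \<and> ((\<exists>y\<in>carrier M. sat M ((asg as)(v := y)) p) \<longrightarrow> sat M ((asg as)(v := x)) p)"
      using x0 by blast
  qed
  have closed: "ev t \<in> carrier M" for t
    using assms wit by (cases t) (auto simp: ev from_nat_into[THEN subsetD[rotated]])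
  define e where "e n = ev (from_nat n)" for n
  have range_e: "range e = range ev"
  proof -
    have "range e = ev ` range from_nat"
      unfolding e_def[abs_def] image_image ..
    then show ?thesis by simp
  qed
  show thesis
  proof (rule that)
    show "X \<subseteq> range e"
    proof
      fix x assume "x \<in> X"
      then have "x = ev (Base (to_nat_on X x))"
        using assms by (simp add: ev)
      then show "x \<in> range e" unfolding range_e by blast
    qed
    show "tarski_vaught M e"
      unfolding tarski_vaught_def
    proof (intro conjI allI impI)
      show "range e \<subseteq> carrier M" using closed by (auto simp: e_def)
      fix s p v assume s: "\<forall>w. s w \<in> range e" and ex: "\<exists>x\<in>carrier M. sat M (s(v := x)) p"
      \<comment> \<open>Since N exceeds all free variables of p, the default value of
        \<open>asg\<close> beyond the list is never consulted.\<close>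
      obtain N where N: "fv p \<subseteq> {..<N}"
        using finite_fv[of p] by (meson finite_nat_bounded)
      have "\<forall>w. \<exists>t. s w = ev t" using s unfolding range_e by blast
      then obtain f where f: "\<And>w. s w = ev (f w)" by metis
      define ts where "ts = map f [0..<N]"
      have "sat M (s(v := x)) p \<longleftrightarrow> sat M ((asg (map ev ts))(v := x)) p" for x
        using N by (intro sat_cong) (auto simp: asg_def ts_def f subset_iff)
      then have "sat M (s(v := ev (Witness p v ts))) p"
        using wit[of p v "map ev ts"] ex by (simp add: ev)
      moreover have "ev (Witness p v ts) \<in> range e" unfolding range_e by blast
      ultimately show "\<exists>k. sat M (s(v := e k)) p" by auto
    qed
  qed
qed

subsection \<open>Ultrapowers on the natural numbers\<close>

text \<open>Zorn's lemma in the reversed order yields a minimal proper filter below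
  \<open>sequentially\<close>; along a chain the infimum stays proper. The meet of a minimal filter
  with a set is the filter itself or improper, which decides every P.\<close>

lemma nonprincipal_ultrafilter:
  obtains U :: "nat filter" where "U \<noteq> bot" "U \<le> sequentially"
    "\<And>P. eventually P U \<or> eventually (\<lambda>n. \<not> P n) U"
proof -
  define A where "A = {F :: nat filter. F \<noteq> bot \<and> F \<le> sequentially}"
  have "\<exists>m\<in>A. \<forall>a\<in>A. a \<le> m \<longrightarrow> a = m"
  proof (rule predicate_Zorn)
    show "partial_order_on A (relation_of (\<lambda>a b. b \<le> a) A)"
      by (rule partial_order_on_relation_ofI) auto
    fix C assume C: "C \<in> Chains (relation_of (\<lambda>a b. b \<le> a) A)"
    then have CA: "C \<subseteq> A" and chain: "a \<le> b \<or> b \<le> a" if "a \<in> C" "b \<in> C" for a b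
      using that by (auto simp: Chains_def relation_of_def)
    show "\<exists>u\<in>A. \<forall>a\<in>C. u \<le> a"
    proof (cases "C = {}")
      case True
      then show ?thesis by (auto simp: A_def intro!: exI[of _ sequentially])
    next
      case False
      have "Inf C \<noteq> bot"
      proof
        assume "Inf C = bot"
        then have "eventually (\<lambda>_. False) (Inf C)" by simp
        then obtain F where "F \<in> C" "eventually (\<lambda>_. False) F"
          using eventually_Inf_base[OF False, of "\<lambda>_. False"] chain by (metis inf.absorb1 inf.absorb2 order_refl)
        then show False using CA by (auto simp: A_def trivial_limit_def)
      qed
      moreover have "Inf C \<le> sequentially"
        using False CA by (auto simp: A_def intro: Inf_lower2)
      ultimately show ?thesis
        by (intro bexI[of _ "Inf C"]) (auto simp: A_def intro: Inf_lower)
    qed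
  qed
  then obtain U where U: "U \<in> A" "\<And>F. F \<in> A \<Longrightarrow> F \<le> U \<Longrightarrow> F = U" by blast
  show thesis
  proof (rule that)
    show "U \<noteq> bot" "U \<le> sequentially" using U(1) by (auto simp: A_def)
    fix P
    show "eventually P U \<or> eventually (\<lambda>n. \<not> P n) U"
    proof (cases "inf U (principal {n. P n}) = bot")
      case True
      then have "eventually (\<lambda>_. False) (inf U (principal {n. P n}))" by simp
      then show ?thesis by (simp add: eventually_inf_principal)
    next
      case False
      then have "inf U (principal {n. P n}) = U"
        using U(1) by (intro U(2)) (auto simp: A_def intro: le_infI1)
      then have "U \<le> principal {n. P n}" by (metis inf.cobounded2)
      then show ?thesis by (simp add: le_principal)
    qed
  qed
qed

locale ultrapower = group G for G (structure) +
  fixes e :: "nat \<Rightarrow> 'a" and U :: "nat filter"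
  assumes tv: "tarski_vaught G e" and U_proper: "U \<noteq> bot"
    and ultra: "eventually P U \<or> eventually (\<lambda>n. \<not> P n) U"
begin

text \<open>A class of sequences is represented by a chosen sequence of indices, so that the ultrapower
  has its carrier in the type \<^typ>\<open>nat \<Rightarrow> nat\<close>.\<close>

definition dec :: "(nat \<Rightarrow> nat) \<Rightarrow> nat \<Rightarrow> 'a" where
  "dec f n = e (f n)"

definition cls :: "(nat \<Rightarrow> 'a) \<Rightarrow> nat \<Rightarrow> nat" where
  "cls a = (SOME f. eventually (\<lambda>n. dec f n = a n) U)"

definition UP :: "(nat \<Rightarrow> nat) monoid" where
  "UP = \<lparr>carrier = {cls a | a. range a \<subseteq> range e},
     monoid.mult = \<lambda>f g. cls (\<lambda>n. dec f n \<otimes> dec g n), one = cls (\<lambda>n. \<one>)\<rparr>"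

lemma e_closed [simp]: "e k \<in> carrier G"
  using tv by (auto simp: tarski_vaught_def)

lemma dec_closed [simp]: "dec f n \<in> carrier G"
  by (simp add: dec_def)

lemma dec_range: "dec f n \<in> range e"
  by (simp add: dec_def)

lemma e_witness:
  "(\<And>w. s w \<in> range e) \<Longrightarrow> x \<in> carrier G \<Longrightarrow> sat G (s(v := x)) p \<Longrightarrow> \<exists>k. sat G (s(v := e k)) p"
  using tv unfolding tarski_vaught_def by blast

text \<open>The Tarski-Vaught property for an equation whose only solution is the product; inverses
  and the unit are obtained likewise.\<close>

lemma range_e_mult: "x \<in> range e \<Longrightarrow> y \<in> range e \<Longrightarrow> x \<otimes> y \<in> range e"
  using e_witness[of "\<lambda>w. if w = 1 then x else y" "x \<otimes> y" 0 "Eq (Var 0) (Mul (Var 1) (Var 2))"]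
  by (auto simp: image_iff) metis

lemma range_e_inv: "x \<in> range e \<Longrightarrow> inv x \<in> range e"
  using e_witness[of "\<lambda>w. x" "inv x" 0 "Eq (Var 0) (Inv (Var 1))"] by (auto simp: image_iff) metis

lemma range_e_one: "\<one> \<in> range e"
  using e_witness[of "\<lambda>w. e 0" "\<one>" 0 "Eq (Var 0) One"] by (auto simp: image_iff) metis

lemma eventually_cong_full:
  "eventually (\<lambda>n. P n \<longleftrightarrow> Q n) U \<Longrightarrow> eventually P U \<longleftrightarrow> eventually Q U"
  by (rule eventually_cong) auto

lemma eventually_const: "eventually (\<lambda>n. P) U \<longleftrightarrow> P"
  using U_proper by simp

lemma dec_cls:
  assumes "\<And>n. a n \<in> range e" shows "eventually (\<lambda>n. dec (cls a) n = a n) U"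
proof -
  obtain f where "\<And>n. a n = e (f n)"
    using assms unfolding image_iff by metis
  then have "eventually (\<lambda>n. dec f n = a n) U" by (simp add: dec_def)
  then show ?thesis unfolding cls_def by (rule someI[where P = "\<lambda>f. eventually (\<lambda>n. dec f n = a n) U"])
qed

lemma cls_cong:
  assumes "eventually (\<lambda>n. a n = b n) U" shows "cls a = cls b"
proof -
  have "eventually (\<lambda>n. dec f n = a n) U \<longleftrightarrow> eventually (\<lambda>n. dec f n = b n) U" for f
    using assms by (rule eventually_cong) simp
  then show ?thesis by (simp add: cls_def)
qed

lemma cls_closed: "(\<And>n. a n \<in> range e) \<Longrightarrow> cls a \<in> carrier UP"
  by (auto simp: UP_def)

lemma cls_dec:
  assumes "f \<in> carrier UP" shows "cls (dec f) = f"
proof -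
  obtain a where a: "f = cls a" "range a \<subseteq> range e" using assms by (auto simp: UP_def)
  then show ?thesis using cls_cong[OF dec_cls[of a]] by auto
qed

lemma UP_eqI:
  assumes "f \<in> carrier UP" "g \<in> carrier UP" "eventually (\<lambda>n. dec f n = dec g n) U"
  shows "f = g"
  using cls_cong[OF assms(3)] assms(1,2) by (simp add: cls_dec)

lemma UP_mult: "f \<otimes>\<^bsub>UP\<^esub> g = cls (\<lambda>n. dec f n \<otimes> dec g n)"
  by (simp add: UP_def)

lemma UP_one: "\<one>\<^bsub>UP\<^esub> = cls (\<lambda>n. \<one>)"
  by (simp add: UP_def)

lemma dec_mult: "eventually (\<lambda>n. dec (f \<otimes>\<^bsub>UP\<^esub> g) n = dec f n \<otimes> dec g n) U"
  unfolding UP_mult by (rule dec_cls) (intro range_e_mult dec_range)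

lemma dec_one: "eventually (\<lambda>n. dec \<one>\<^bsub>UP\<^esub> n = \<one>) U"
  unfolding UP_one by (rule dec_cls) (rule range_e_one)

lemma UP_mult_closed: "f \<otimes>\<^bsub>UP\<^esub> g \<in> carrier UP"
  unfolding UP_mult by (intro cls_closed range_e_mult dec_range)

lemma group_UP: "group UP"
proof (rule groupI)
  show "x \<otimes>\<^bsub>UP\<^esub> y \<in> carrier UP" for x y by (rule UP_mult_closed)
  show one: "\<one>\<^bsub>UP\<^esub> \<in> carrier UP"
    unfolding UP_one by (intro cls_closed range_e_one)
  show "x \<otimes>\<^bsub>UP\<^esub> y \<otimes>\<^bsub>UP\<^esub> z = x \<otimes>\<^bsub>UP\<^esub> (y \<otimes>\<^bsub>UP\<^esub> z)" for x y z
  proof (rule UP_eqI[OF UP_mult_closed UP_mult_closed])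
    show "eventually (\<lambda>n. dec (x \<otimes>\<^bsub>UP\<^esub> y \<otimes>\<^bsub>UP\<^esub> z) n = dec (x \<otimes>\<^bsub>UP\<^esub> (y \<otimes>\<^bsub>UP\<^esub> z)) n) U"
      using dec_mult[of "x \<otimes>\<^bsub>UP\<^esub> y" z] dec_mult[of x y] dec_mult[of x "y \<otimes>\<^bsub>UP\<^esub> z"] dec_mult[of y z]
      by eventually_elim (simp add: m_assoc)
  qed
  show "\<one>\<^bsub>UP\<^esub> \<otimes>\<^bsub>UP\<^esub> x = x" if "x \<in> carrier UP" for x
  proof (rule UP_eqI[OF UP_mult_closed that])
    show "eventually (\<lambda>n. dec (\<one>\<^bsub>UP\<^esub> \<otimes>\<^bsub>UP\<^esub> x) n = dec x n) U"
      using dec_mult[of "\<one>\<^bsub>UP\<^esub>" x] dec_one by eventually_elim simp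
  qed
  fix x assume "x \<in> carrier UP"
  define y where "y = cls (\<lambda>n. inv (dec x n))"
  have y: "eventually (\<lambda>n. dec y n = inv (dec x n)) U"
    unfolding y_def by (rule dec_cls) (intro range_e_inv dec_range)
  have "y \<otimes>\<^bsub>UP\<^esub> x = \<one>\<^bsub>UP\<^esub>"
  proof (rule UP_eqI[OF UP_mult_closed one])
    show "eventually (\<lambda>n. dec (y \<otimes>\<^bsub>UP\<^esub> x) n = dec \<one>\<^bsub>UP\<^esub> n) U"
      using dec_mult[of y x] y dec_one by eventually_elim simp
  qed
  moreover have "y \<in> carrier UP"
    unfolding y_def by (intro cls_closed range_e_inv dec_range)
  ultimately show "\<exists>y\<in>carrier UP. y \<otimes>\<^bsub>UP\<^esub> x = \<one>\<^bsub>UP\<^esub>" by blast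
qed

lemma dec_inv:
  assumes "f \<in> carrier UP"
  shows "eventually (\<lambda>n. dec (inv\<^bsub>UP\<^esub> f) n = inv (dec f n)) U"
proof -
  have "eventually (\<lambda>n. dec (inv\<^bsub>UP\<^esub> f) n \<otimes> dec f n = \<one>) U"
    using dec_mult[of "inv\<^bsub>UP\<^esub> f" f] dec_one
    by eventually_elim (simp add: group.l_inv[OF group_UP assms])
  then show ?thesis
    by (rule eventually_mono) (simp add: inv_equality)
qed

lemma dec_pow: "eventually (\<lambda>n. dec (f [^]\<^bsub>UP\<^esub> (k::nat)) n = dec f n [^] k) U"
proof (induction k)
  case 0
  then show ?case using dec_one by simp
next
  case (Suc k)
  show ?case
    using Suc dec_mult[of "f [^]\<^bsub>UP\<^esub> k" f] by eventually_elim simp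
qed

lemma UP_eq_iff:
  assumes "f \<in> carrier UP" "g \<in> carrier UP"
  shows "f = g \<longleftrightarrow> eventually (\<lambda>n. dec f n = dec g n) U"
  using UP_eqI[OF assms] by auto

lemma UP_commute_iff:
  "f \<otimes>\<^bsub>UP\<^esub> g = g \<otimes>\<^bsub>UP\<^esub> f \<longleftrightarrow> eventually (\<lambda>n. dec f n \<otimes> dec g n = dec g n \<otimes> dec f n) U"
  unfolding UP_eq_iff[OF UP_mult_closed UP_mult_closed]
proof (rule eventually_cong_full)
  show "eventually (\<lambda>n. dec (f \<otimes>\<^bsub>UP\<^esub> g) n = dec (g \<otimes>\<^bsub>UP\<^esub> f) n \<longleftrightarrow>
      dec f n \<otimes> dec g n = dec g n \<otimes> dec f n) U"
    using dec_mult[of f g] dec_mult[of g f] by eventually_elim simp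
qed

lemma val_UP:
  assumes "\<And>v. s v \<in> carrier UP"
  shows "val UP s t \<in> carrier UP \<and> eventually (\<lambda>n. dec (val UP s t) n = val G (\<lambda>v. dec (s v) n) t) U"
proof (induction t)
  case (Var v)
  then show ?case using assms by simp
next
  case One
  then show ?case using dec_one group.is_monoid[OF group_UP] by (simp add: monoid.one_closed)
next
  case (Mul t u)
  then have "eventually (\<lambda>n. dec (val UP s t) n = val G (\<lambda>v. dec (s v) n) t) U"
    "eventually (\<lambda>n. dec (val UP s u) n = val G (\<lambda>v. dec (s v) n) u) U" by auto
  with dec_mult[of "val UP s t" "val UP s u"]
  have "eventually (\<lambda>n. dec (val UP s (Mul t u)) n = val G (\<lambda>v. dec (s v) n) (Mul t u)) U"
    by eventually_elim simp
  then show ?case by (simp add: UP_mult_closed)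
next
  case (Inv t)
  then have "eventually (\<lambda>n. dec (val UP s t) n = val G (\<lambda>v. dec (s v) n) t) U"
    and closed: "val UP s t \<in> carrier UP" by auto
  from this(1) dec_inv[OF closed]
  have "eventually (\<lambda>n. dec (val UP s (Inv t)) n = val G (\<lambda>v. dec (s v) n) (Inv t)) U"
    by eventually_elim simp
  then show ?case using closed group.inv_closed[OF group_UP] by simp
qed

text \<open>The right-hand side refers to the whole group rather than to \<open>range e\<close>. In
  the quantifier case the Tarski-Vaught property finds counterexamples among the \<open>e k\<close>,
  and these are the coordinates of an element of the ultrapower; elementarity enters only
  there.\<close>

theorem Los:
  assumes "\<And>v. s v \<in> carrier UP"
  shows "sat UP s p \<longleftrightarrow> eventually (\<lambda>n. sat G (\<lambda>v. dec (s v) n) p) U"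
  using assms
proof (induction p arbitrary: s)
  case (Eq t u)
  have t: "val UP s t \<in> carrier UP" "eventually (\<lambda>n. dec (val UP s t) n = val G (\<lambda>v. dec (s v) n) t) U"
    and u: "val UP s u \<in> carrier UP" "eventually (\<lambda>n. dec (val UP s u) n = val G (\<lambda>v. dec (s v) n) u) U"
    using val_UP[of s, OF Eq.prems] by auto
  show ?case
    unfolding sat.simps UP_eq_iff[OF t(1) u(1)]
  proof (rule eventually_cong_full)
    show "eventually (\<lambda>n. dec (val UP s t) n = dec (val UP s u) n \<longleftrightarrow>
        val G (\<lambda>v. dec (s v) n) t = val G (\<lambda>v. dec (s v) n) u) U"
      using t(2) u(2) by eventually_elim simp
  qed
next
  case (Neg p)
  have "\<not> (eventually P U \<and> eventually (\<lambda>n. \<not> P n) U)" for P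
    using U_proper by (auto dest: eventually_conj)
  from this[of "\<lambda>n. sat G (\<lambda>v. dec (s v) n) p"] show ?case
    using ultra[of "\<lambda>n. sat G (\<lambda>v. dec (s v) n) p"] unfolding sat.simps Neg.IH[OF Neg.prems] by argo
next
  case (Conj p q)
  then show ?case by (simp add: eventually_conj_iff)
next
  case (All v p)
  let ?s = "\<lambda>n w. dec (s w) n"
  have upd: "(\<lambda>w. dec ((s(v := f)) w) n) = (?s n)(v := dec f n)" for f n
    by auto
  have IH: "sat UP (s(v := f)) p \<longleftrightarrow> eventually (\<lambda>n. sat G ((?s n)(v := dec f n)) p) U"
    if "f \<in> carrier UP" for f
  proof (rule All.IH[of "s(v := f)", unfolded upd])
    show "(s(v := f)) w \<in> carrier UP" for w
      using All.prems that by simp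
  qed
  show ?case
  proof
    assume "sat UP s (All v p)"
    then have all: "eventually (\<lambda>n. sat G ((?s n)(v := dec f n)) p) U" if "f \<in> carrier UP" for f
      using IH that by simp
    show "eventually (\<lambda>n. sat G (?s n) (All v p)) U"
    proof (rule ccontr)
      assume "\<not> ?thesis"
      then have ev: "eventually (\<lambda>n. \<not> sat G (?s n) (All v p)) U"
        using ultra by blast
      have "\<exists>k. \<not> sat G (?s n) (All v p) \<longrightarrow> sat G ((?s n)(v := e k)) (Neg p)" for n
        using e_witness[of "?s n" _ v "Neg p"] dec_range by auto
      then obtain k where k: "\<And>n. \<not> sat G (?s n) (All v p) \<Longrightarrow> \<not> sat G ((?s n)(v := e (k n))) p"
        by (metis sat.simps(2))
      define f where "f = cls (\<lambda>n. e (k n))"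
      have "eventually (\<lambda>n. sat G ((?s n)(v := dec f n)) p) U"
        unfolding f_def by (intro all cls_closed) simp
      moreover have "eventually (\<lambda>n. dec f n = e (k n)) U"
        unfolding f_def by (rule dec_cls) simp
      ultimately have "eventually (\<lambda>n. False) U"
        using ev by eventually_elim (use k in auto)
      then show False using U_proper by simp
    qed
  next
    assume "eventually (\<lambda>n. sat G (?s n) (All v p)) U"
    then have "eventually (\<lambda>n. sat G ((?s n)(v := dec f n)) p) U" for f
      by (rule eventually_mono) simp
    then show "sat UP s (All v p)"
      using IH by simp
  qed
qed

corollary is_model_UP: "is_model UP (Th G)"
  unfolding is_model_def
proof (intro conjI ballI group_UP)
  fix p assume "p \<in> Th G"
  then have "sat G (\<lambda>v. dec (s v) n) p" for s n
    by (auto simp: Th_def holds_def)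
  then show "holds UP p"
    by (simp add: holds_def Los)
qed

end

subsection \<open>Finite configurations\<close>

lemma add_diff_mod_cancel:
  assumes "v < m" "d \<le> (m::nat)"
  shows "((v + d) mod m + (m - d)) mod m = v" "((v + (m - d)) mod m + d) mod m = v"
proof -
  have "(v + d) + (m - d) = v + m" "(v + (m - d)) + d = v + m"
    using assms(2) by simp_all
  then show "((v + d) mod m + (m - d)) mod m = v" "((v + (m - d)) mod m + d) mod m = v"
    using assms(1) by (simp_all only: mod_add_left_eq mod_add_self2 mod_less)
qed

context group
begin

lemma conj_by_pow_family:
  assumes u: "u \<in> carrier G" and c: "\<And>i. i \<in> I \<Longrightarrow> c i \<in> carrier G"
    and \<sigma>: "\<And>i. i \<in> I \<Longrightarrow> \<sigma> i \<in> I" "\<And>i. i \<in> I \<Longrightarrow> conj_by u (c i) = c (\<sigma> i)"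
    and i: "i \<in> I"
  shows "conj_by (u [^] (k::nat)) (c i) = c ((\<sigma> ^^ k) i)"
proof -
  have "(\<sigma> ^^ k) i \<in> I \<and> conj_by (u [^] k) (c i) = c ((\<sigma> ^^ k) i)"
    using i by (induction k) (auto simp: u c \<sigma> conj_by_by_mult)
  then show ?thesis by blast
qed

end

context inner_ultrahomogeneous_group
begin

lemma symmetric_family:
  assumes "infinite_exponent G" "finite I"
  obtains c :: "'i \<Rightarrow> 'a" where "\<And>i. c i \<in> carrier G" "inj_on c I"
    "\<And>\<sigma>. bij_betw \<sigma> I I \<Longrightarrow> \<exists>u\<in>carrier G. \<forall>i\<in>I. conj_by u (c i) = c (\<sigma> i)"
proof -
  obtain m \<theta> where m: "\<not> m dvd 1" "homocyclic (Suc (card I)) m \<theta>"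
    using homocyclic_arbitrary_rank[OF assms(1)] by metis
  obtain d :: "nat \<Rightarrow> 'a" where d: "\<And>i. d i \<in> carrier G" "inj_on d {..<card I}"
    "\<And>\<sigma>. bij_betw \<sigma> {..<card I} {..<card I} \<Longrightarrow> \<exists>u\<in>carrier G. \<forall>i<card I. conj_by u (d i) = d (\<sigma> i)"
    using homocyclic_symmetric_family[OF homocyclic_restrict[OF m(2)] m(1)] by metis
  obtain f where f: "bij_betw f I {..<card I}"
    using ex_bij_betw_finite_nat[OF assms(2)] by (auto simp: atLeast0LessThan)
  define g where "g = the_inv_into I f"
  have g: "bij_betw g {..<card I} I" "\<And>i. i \<in> I \<Longrightarrow> g (f i) = i"
    using bij_betw_the_inv_into[OF f] the_inv_into_f_f[OF bij_betw_imp_inj_on[OF f]]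
    unfolding g_def by auto
  show thesis
  proof (rule that[of "d \<circ> f"])
    show "(d \<circ> f) i \<in> carrier G" for i using d by simp
    show "inj_on (d \<circ> f) I"
      using f d(2) by (intro comp_inj_on) (auto simp: bij_betw_def)
    fix \<sigma> :: "'i \<Rightarrow> 'i" assume "bij_betw \<sigma> I I"
    then have "bij_betw (f \<circ> (\<sigma> \<circ> g)) {..<card I} {..<card I}"
      using g(1) f by (intro bij_betw_trans)
    then obtain u where "u \<in> carrier G" "\<forall>i<card I. conj_by u (d i) = d ((f \<circ> (\<sigma> \<circ> g)) i)"
      using d(3) by blast
    then show "\<exists>u\<in>carrier G. \<forall>i\<in>I. conj_by u ((d \<circ> f) i) = (d \<circ> f) (\<sigma> i)"
      using bij_betwE[OF f] g(2) by (intro bexI[of _ u]) auto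
  qed
qed

text \<open>\<open>g\<close> permutes the first half of a symmetric family cyclically, and \<open>b S\<close> moves exactly those
  elements of this half whose index is not in \<open>S\<close>, by exchanging them with the second half.\<close>

lemma finite_independence_pattern:
  assumes "infinite_exponent G"
  shows "\<exists>g c b. g \<in> carrier G \<and> c \<in> carrier G \<and> (\<forall>S. b S \<in> carrier G) \<and>
    (\<forall>S::nat set. \<forall>i<N. conj_by (g [^] i) c \<otimes> b S = b S \<otimes> conj_by (g [^] i) c \<longleftrightarrow> i \<in> S)"
proof (cases "N = 0")
  case True
  then show ?thesis by (intro exI[of _ \<one>] exI[of _ "\<lambda>_. \<one>"]) auto
next
  case False
  obtain c :: "nat \<Rightarrow> 'a" where c: "\<And>i. c i \<in> carrier G" "inj_on c {..<2 * N}"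
    "\<And>\<sigma>. bij_betw \<sigma> {..<2 * N} {..<2 * N} \<Longrightarrow> \<exists>u\<in>carrier G. \<forall>i\<in>{..<2 * N}. conj_by u (c i) = c (\<sigma> i)"
    using symmetric_family[OF assms, of "{..<2 * N}"] by (metis finite_lessThan)
  define \<sigma> where "\<sigma> i = (if i < N then (i + 1) mod N else i)" for i
  have \<sigma>_mod: "((i + 1) mod N + (N - 1)) mod N = i" "((i + (N - 1)) mod N + 1) mod N = i" if "i < N" for i
    using add_diff_mod_cancel[of i N 1] that False by simp_all
  have "bij_betw \<sigma> {..<2 * N} {..<2 * N}"
  proof (rule bij_betw_byWitness[where f' = "\<lambda>i. if i < N then (i + (N - 1)) mod N else i"])
    show "\<forall>i\<in>{..<2 * N}. (if \<sigma> i < N then (\<sigma> i + (N - 1)) mod N else \<sigma> i) = i"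
      using \<sigma>_mod False by (auto simp: \<sigma>_def)
    show "\<forall>i\<in>{..<2 * N}. \<sigma> (if i < N then (i + (N - 1)) mod N else i) = i"
      using \<sigma>_mod False by (auto simp: \<sigma>_def)
    show "\<sigma> ` {..<2 * N} \<subseteq> {..<2 * N}"
      using False by (auto simp: \<sigma>_def intro: less_le_trans[OF mod_less_divisor])
    show "(\<lambda>i. if i < N then (i + (N - 1)) mod N else i) ` {..<2 * N} \<subseteq> {..<2 * N}"
      using False by (auto intro: less_le_trans[OF mod_less_divisor])
  qed
  then obtain g where g: "g \<in> carrier G" "\<And>i. i < 2 * N \<Longrightarrow> conj_by g (c i) = c (\<sigma> i)"
    using c(3) by blast
  have g_pow: "conj_by (g [^] i) (c 0) = c i" if "i < N" for i
    using that
  proof (induction i)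
    case (Suc i)
    then show ?case
      using g(1) c(1) g(2)[of i] by (simp add: conj_by_by_mult \<sigma>_def)
  qed (use c in simp)
  have "\<exists>b\<in>carrier G. \<forall>i<N. c i \<otimes> b = b \<otimes> c i \<longleftrightarrow> i \<in> S" for S
  proof -
    define \<tau> where "\<tau> i = (if i < N \<and> i \<notin> S then i + N else if N \<le> i \<and> i - N \<notin> S then i - N else i)" for i
    have "bij_betw \<tau> {..<2 * N} {..<2 * N}"
      by (rule bij_betw_byWitness[where f' = \<tau>]) (auto simp: \<tau>_def)
    then obtain b where b: "b \<in> carrier G" "\<And>i. i < 2 * N \<Longrightarrow> conj_by b (c i) = c (\<tau> i)"
      using c(3) by blast
    have "c i \<otimes> b = b \<otimes> c i \<longleftrightarrow> i \<in> S" if "i < N" for i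
    proof -
      have "c i \<otimes> b = b \<otimes> c i \<longleftrightarrow> c (\<tau> i) = c i"
        using b(1) b(2)[of i] c(1) that by (simp flip: conj_by_eq_self_iff)
      also have "\<dots> \<longleftrightarrow> \<tau> i = i"
        using that by (intro inj_on_eq_iff[OF c(2)]) (auto simp: \<tau>_def)
      finally show ?thesis using that by (auto simp: \<tau>_def)
    qed
    then show ?thesis using b(1) by blast
  qed
  then obtain b where "\<And>S. b S \<in> carrier G" "\<And>S i. i < N \<Longrightarrow> c i \<otimes> b S = b S \<otimes> c i \<longleftrightarrow> i \<in> S"
    by metis
  then show ?thesis
    using g(1) c(1) g_pow by (intro exI[of _ g] exI[of _ "c 0"] exI[of _ b]) auto
qed

text \<open>Each \<open>u i\<close> acts on a symmetric family indexed by pairs \<open>(l, v)\<close> by rotating the residue \<open>v\<close>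
  modulo \<open>2\<^sup>N\<close>, in cycles of length \<open>2\<^bsup>l!i+1\<^esup>\<close>; \<open>x l\<close> is the element with index \<open>(l, 0)\<close>.\<close>

lemma finite_array_pattern:
  assumes "infinite_exponent G"
  shows "\<exists>u x. (\<forall>i::nat. u i \<in> carrier G) \<and> (\<forall>l. x l \<in> carrier G) \<and>
    (\<forall>l. length l = N \<and> set l \<subseteq> {..<N} \<longrightarrow> (\<forall>i<N. \<forall>j::nat.
       x l \<otimes> u i [^] ((2::nat) ^ j) = u i [^] ((2::nat) ^ j) \<otimes> x l \<longleftrightarrow> l ! i < j))"
proof -
  define I where "I = {l :: nat list. set l \<subseteq> {..<N} \<and> length l = N} \<times> {..<(2::nat) ^ N}"
  have "finite I"
    unfolding I_def by (intro finite_cartesian_product finite_lists_length_eq) auto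
  then obtain c :: "nat list \<times> nat \<Rightarrow> 'a" where c: "\<And>i. c i \<in> carrier G" "inj_on c I"
    "\<And>\<sigma>. bij_betw \<sigma> I I \<Longrightarrow> \<exists>u\<in>carrier G. \<forall>i\<in>I. conj_by u (c i) = c (\<sigma> i)"
    using symmetric_family[OF assms, of I] by metis
  \<comment> \<open>The - 1 in the exponent makes the 2^j-th iterate fix (l, 0) precisely for the
    strict inequality \<open>l ! i < j\<close>.\<close>
  define \<sigma> where "\<sigma> i = (\<lambda>(l :: nat list, v). (l, (v + (2::nat) ^ (N - 1 - l ! i)) mod 2 ^ N))" for i
  have \<sigma>_I: "\<sigma> i y \<in> I" if "y \<in> I" for i y
    using that by (auto simp: I_def \<sigma>_def)
  have "bij_betw (\<sigma> i) I I" for i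
  proof (rule bij_betw_byWitness[where f' =
        "\<lambda>(l, v). (l, (v + (2 ^ N - (2::nat) ^ (N - 1 - l ! i))) mod 2 ^ N)"])
    have le: "(2::nat) ^ (N - 1 - k) \<le> 2 ^ N" for k
      by (intro power_increasing) auto
    have mod: "((v + 2 ^ (N - 1 - k)) mod 2 ^ N + (2 ^ N - 2 ^ (N - 1 - k))) mod 2 ^ N = v"
      "((v + (2 ^ N - 2 ^ (N - 1 - k))) mod 2 ^ N + 2 ^ (N - 1 - k)) mod 2 ^ N = v"
      if "v < 2 ^ N" for v k :: nat
      using that le[of k] by (simp_all only: add_diff_mod_cancel)
    show "\<forall>y\<in>I. (case \<sigma> i y of (l, v) \<Rightarrow> (l, (v + (2 ^ N - (2::nat) ^ (N - 1 - l ! i))) mod 2 ^ N)) = y"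
      "\<forall>y\<in>I. \<sigma> i (case y of (l, v) \<Rightarrow> (l, (v + (2 ^ N - (2::nat) ^ (N - 1 - l ! i))) mod 2 ^ N)) = y"
      using mod by (auto simp: I_def \<sigma>_def)
  qed (auto simp: I_def \<sigma>_def)
  then have "\<exists>u\<in>carrier G. \<forall>y\<in>I. conj_by u (c y) = c (\<sigma> i y)" for i
    using c(3) by blast
  then obtain u where u: "\<And>i. u i \<in> carrier G" "\<And>i y. y \<in> I \<Longrightarrow> conj_by (u i) (c y) = c (\<sigma> i y)"
    by metis
  have \<sigma>_pow: "(\<sigma> i ^^ k) (l, 0) = (l, (k * 2 ^ (N - 1 - l ! i)) mod 2 ^ N)" for i k l
    by (induction k) (auto simp: \<sigma>_def mod_simps add.commute)
  have "c (l, 0) \<otimes> u i [^] ((2::nat) ^ j) = u i [^] ((2::nat) ^ j) \<otimes> c (l, 0) \<longleftrightarrow> l ! i < j"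
    if l: "length l = N" "set l \<subseteq> {..<N}" "i < N" for l i j
  proof -
    have lI: "(l, 0) \<in> I" using l by (simp add: I_def)
    have "l ! i < N" using l nth_mem[of i l] by (auto simp del: nth_mem)
    have "c (l, 0) \<otimes> u i [^] ((2::nat) ^ j) = u i [^] ((2::nat) ^ j) \<otimes> c (l, 0) \<longleftrightarrow>
        c ((\<sigma> i ^^ 2 ^ j) (l, 0)) = c (l, 0)"
      using conj_by_pow_family[of "u i" I c "\<sigma> i" "(l, 0)" "2 ^ j"] u c(1) \<sigma>_I lI
        conj_by_eq_self_iff[of "u i [^] ((2::nat) ^ j)" "c (l, 0)"] by simp
    also have "\<dots> \<longleftrightarrow> (\<sigma> i ^^ 2 ^ j) (l, 0) = (l, 0)"
      using lI by (intro inj_on_eq_iff[OF c(2)]) (auto simp: \<sigma>_pow I_def)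
    also have "\<dots> \<longleftrightarrow> (2::nat) ^ N dvd 2 ^ (j + (N - 1 - l ! i))"
      by (simp add: \<sigma>_pow dvd_eq_mod_eq_0 power_add)
    also have "\<dots> \<longleftrightarrow> N \<le> j + (N - 1 - l ! i)"
      by (simp add: dvd_power_iff_le)
    also have "\<dots> \<longleftrightarrow> l ! i < j"
      using \<open>l ! i < N\<close> by auto
    finally show ?thesis .
  qed
  then show ?thesis
    using u(1) c(1) by (intro exI[of _ u] exI[of _ "\<lambda>l. c (l, 0)"]) auto
qed

end

subsection \<open>Infinite patterns in the ultrapower\<close>

context ultrapower
begin

lemma dec_conj_by:
  assumes "f \<in> carrier UP"
  shows "eventually (\<lambda>n. dec (group.conj_by UP f g) n = conj_by (dec f n) (dec g n)) U"
  unfolding group.conj_by_def[OF group_UP] conj_by_def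
  using dec_mult[of "inv\<^bsub>UP\<^esub> f \<otimes>\<^bsub>UP\<^esub> g" f] dec_mult[of "inv\<^bsub>UP\<^esub> f" g] dec_inv[OF assms]
  by eventually_elim simp

lemma UP_commute_iff_const:
  assumes "eventually (\<lambda>n. dec f n \<otimes> dec g n = dec g n \<otimes> dec f n \<longleftrightarrow> P) U"
  shows "f \<otimes>\<^bsub>UP\<^esub> g = g \<otimes>\<^bsub>UP\<^esub> f \<longleftrightarrow> P"
  unfolding UP_commute_iff eventually_cong_full[OF assms] by (rule eventually_const)

end

text \<open>The sequence consists of the conjugates of one c by the powers of one g, both
  independent of S. Exponents add under multiplication, so a product of n powers of g can address
  any member; this serves n-independence.\<close>

definition independence_pattern :: "('a, 'b) monoid_scheme \<Rightarrow> bool" where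
  "independence_pattern M \<longleftrightarrow> (\<exists>g\<in>carrier M. \<exists>c\<in>carrier M. \<forall>S::nat set. \<exists>b\<in>carrier M. \<forall>i.
     group.conj_by M (g [^]\<^bsub>M\<^esub> i) c \<otimes>\<^bsub>M\<^esub> b = b \<otimes>\<^bsub>M\<^esub> group.conj_by M (g [^]\<^bsub>M\<^esub> i) c \<longleftrightarrow> i \<in> S)"

text \<open>In each row the centralisers of the listed powers increase with j, and f prescribes
  where x enters the chain of every row. One row yields the strict order property, all rows together
  the tree property.\<close>

definition array_pattern :: "('a, 'b) monoid_scheme \<Rightarrow> bool" where
  "array_pattern M \<longleftrightarrow> (\<exists>u::nat \<Rightarrow> 'a. range u \<subseteq> carrier M \<and> (\<forall>f. \<exists>x\<in>carrier M. \<forall>i j.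
     x \<otimes>\<^bsub>M\<^esub> u i [^]\<^bsub>M\<^esub> ((2::nat) ^ j) = u i [^]\<^bsub>M\<^esub> ((2::nat) ^ j) \<otimes>\<^bsub>M\<^esub> x \<longleftrightarrow> f i < j))"

context inner_ultrahomogeneous_group
begin

theorem model_with_patterns:
  assumes "infinite_exponent G"
  shows "\<exists>M :: (nat \<Rightarrow> nat) monoid. is_model M (Th G) \<and> independence_pattern M \<and> array_pattern M"
proof -
  define P where "P N g c b \<longleftrightarrow> g \<in> carrier G \<and> c \<in> carrier G \<and> (\<forall>S. b S \<in> carrier G) \<and>
    (\<forall>S. \<forall>i<N. conj_by (g [^] i) c \<otimes> b S = b S \<otimes> conj_by (g [^] i) c \<longleftrightarrow> i \<in> S)"
    for N :: nat and g c b
  have "\<exists>g c b. P N g c b" for N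
    unfolding P_def by (rule finite_independence_pattern[OF assms])
  then obtain g c b where P: "\<And>N. P N (g N) (c N) (b N)" by metis
  have gcb: "g N \<in> carrier G" "c N \<in> carrier G" "b N S \<in> carrier G"
    "i < N \<Longrightarrow> conj_by (g N [^] i) (c N) \<otimes> b N S = b N S \<otimes> conj_by (g N [^] i) (c N) \<longleftrightarrow> i \<in> S" for N S i
    using P[of N] by (simp_all add: P_def)
  define Q where "Q N u x \<longleftrightarrow> (\<forall>i::nat. u i \<in> carrier G) \<and> (\<forall>l. x l \<in> carrier G) \<and>
    (\<forall>l. length l = N \<and> set l \<subseteq> {..<N} \<longrightarrow> (\<forall>i<N. \<forall>j::nat.
       x l \<otimes> u i [^] ((2::nat) ^ j) = u i [^] ((2::nat) ^ j) \<otimes> x l \<longleftrightarrow> l ! i < j))"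
    for N :: nat and u x
  have "\<exists>u x. Q N u x" for N
    unfolding Q_def by (rule finite_array_pattern[OF assms])
  then obtain u x where Q: "\<And>N. Q N (u N) (x N)" by metis
  have ux: "u N i \<in> carrier G" "x N l \<in> carrier G"
    "length l = N \<Longrightarrow> set l \<subseteq> {..<N} \<Longrightarrow> i < N \<Longrightarrow>
       x N l \<otimes> u N i [^] ((2::nat) ^ j) = u N i [^] ((2::nat) ^ j) \<otimes> x N l \<longleftrightarrow> l ! i < j" for N l i j
    using Q[of N] by (simp_all add: Q_def)
  define X where "X = range g \<union> range c \<union> range (\<lambda>(N, k). b N (set_decode k)) \<union>
    range (\<lambda>(N, i). u N i) \<union> range (\<lambda>(N, l). x N l)"
  have "countable X" unfolding X_def by (intro countable_Un countable_image) auto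
  moreover have "X \<subseteq> carrier G" "X \<noteq> {}" unfolding X_def using gcb ux by auto
  ultimately obtain e :: "nat \<Rightarrow> 'a" where e: "X \<subseteq> range e" "tarski_vaught G e"
    by (rule countable_elementary_substructure)
  obtain U :: "nat filter" where U: "U \<noteq> bot" "U \<le> sequentially"
    "\<And>P. eventually P U \<or> eventually (\<lambda>n. \<not> P n) U"
    by (rule nonprincipal_ultrafilter) (rule that)
  interpret ultrapower G e U
    using e(2) U by unfold_locales auto
  \<comment> \<open>Each finite pattern is correct only for indices below N; as U refines
    \<open>sequentially\<close>, any given index is eventually below N.\<close>
  have large: "eventually (\<lambda>N. i < N) U" for i
    using eventually_gt_at_top[of i] U(2) by (rule filter_leD[rotated])
  have "u N i \<in> range (\<lambda>(N, i). u N i)" for N i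
    by (rule range_eqI[of _ _ "(N, i)"]) simp
  moreover have "x N l \<in> range (\<lambda>(N, l). x N l)" for N l
    by (rule range_eqI[of _ _ "(N, l)"]) simp
  ultimately have in_e: "g N \<in> range e" "c N \<in> range e" "u N i \<in> range e" "x N l \<in> range e" for N i l
    using rangeI[of g N] rangeI[of c N] by (auto simp only: X_def intro!: subsetD[OF e(1)])
  have b_e: "b N (S \<inter> {..<N}) \<in> range e" for N S
  proof -
    have "b N (S \<inter> {..<N}) = (\<lambda>(N, k). b N (set_decode k)) (N, set_encode (S \<inter> {..<N}))"
      by simp
    then have "b N (S \<inter> {..<N}) \<in> range (\<lambda>(N, k). b N (set_decode k))"
      by (rule range_eqI)
    then show ?thesis by (auto simp only: X_def intro!: subsetD[OF e(1)])
  qed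
  have "independence_pattern UP"
    unfolding independence_pattern_def
  proof (rule bexI[of _ "cls g"], rule bexI[of _ "cls c"], rule allI)
    show "cls g \<in> carrier UP" "cls c \<in> carrier UP"
      by (intro cls_closed in_e)+
    fix S :: "nat set"
    let ?b = "cls (\<lambda>N. b N (S \<inter> {..<N}))"
    have "?b \<in> carrier UP" by (intro cls_closed b_e)
    moreover have "group.conj_by UP (cls g [^]\<^bsub>UP\<^esub> i) (cls c) \<otimes>\<^bsub>UP\<^esub> ?b =
        ?b \<otimes>\<^bsub>UP\<^esub> group.conj_by UP (cls g [^]\<^bsub>UP\<^esub> i) (cls c) \<longleftrightarrow> i \<in> S" for i :: nat
    proof (rule UP_commute_iff_const)
      let ?a = "group.conj_by UP (cls g [^]\<^bsub>UP\<^esub> i) (cls c)"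
      have closed: "cls g [^]\<^bsub>UP\<^esub> i \<in> carrier UP"
      using group.is_monoid[OF group_UP] \<open>cls g \<in> carrier UP\<close> by (rule monoid.nat_pow_closed)
      show "eventually (\<lambda>n. dec ?a n \<otimes> dec ?b n = dec ?b n \<otimes> dec ?a n \<longleftrightarrow> i \<in> S) U"
        using dec_conj_by[OF closed, of "cls c"] dec_pow[of "cls g" i] dec_cls[of g, OF in_e(1)]
          dec_cls[of c, OF in_e(2)] dec_cls[of "\<lambda>N. b N (S \<inter> {..<N})", OF b_e] large[of i]
        by eventually_elim (simp add: gcb(4))
    qed
    ultimately show "\<exists>b\<in>carrier UP. \<forall>i. group.conj_by UP (cls g [^]\<^bsub>UP\<^esub> i) (cls c) \<otimes>\<^bsub>UP\<^esub> b =
        b \<otimes>\<^bsub>UP\<^esub> group.conj_by UP (cls g [^]\<^bsub>UP\<^esub> i) (cls c) \<longleftrightarrow> i \<in> S"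
      by blast
  qed
  moreover have "array_pattern UP"
    unfolding array_pattern_def
  proof (intro exI[of _ "\<lambda>i. cls (\<lambda>N. u N i)"] conjI allI)
    show "range (\<lambda>i. cls (\<lambda>N. u N i)) \<subseteq> carrier UP"
      by (auto intro!: cls_closed in_e)
    fix f :: "nat \<Rightarrow> nat"
    \<comment> \<open>The path f is cut to N entries below N. For j < N, truncating at N - 1 does
      not affect whether \<open>f i < j\<close>.\<close>
    define l where "l N = map (\<lambda>i. min (f i) (N - 1)) [0..<N]" for N
    let ?x = "cls (\<lambda>N. x N (map (\<lambda>i. min (f i) (N - 1)) [0..<N]))"
    have l: "x N (l N) \<otimes> u N i [^] ((2::nat) ^ j) = u N i [^] ((2::nat) ^ j) \<otimes> x N (l N) \<longleftrightarrow> f i < j"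
      if "i < N" "j < N" for N i j
    proof -
      have "length (l N) = N" "set (l N) \<subseteq> {..<N}" "l N ! i = min (f i) (N - 1)"
        using that by (auto simp: l_def)
      then show ?thesis using ux(3)[of "l N" N i j] that by auto
    qed
    have "?x \<in> carrier UP" by (intro cls_closed in_e)
    moreover have "?x \<otimes>\<^bsub>UP\<^esub> cls (\<lambda>N. u N i) [^]\<^bsub>UP\<^esub> ((2::nat) ^ j) =
        cls (\<lambda>N. u N i) [^]\<^bsub>UP\<^esub> ((2::nat) ^ j) \<otimes>\<^bsub>UP\<^esub> ?x \<longleftrightarrow> f i < j" for i j :: nat
    proof (rule UP_commute_iff_const)
      let ?u = "cls (\<lambda>N. u N i) [^]\<^bsub>UP\<^esub> ((2::nat) ^ j)"
      show "eventually (\<lambda>n. dec ?x n \<otimes> dec ?u n = dec ?u n \<otimes> dec ?x n \<longleftrightarrow> f i < j) U"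
        using dec_pow[of "cls (\<lambda>N. u N i)" "2 ^ j"] dec_cls[of "\<lambda>N. u N i", OF in_e(3)]
          dec_cls[of "\<lambda>N. x N (l N)", OF in_e(4)] large[of i] large[of j]
        unfolding l_def[symmetric] by eventually_elim (simp add: l)
    qed
    ultimately show "\<exists>x\<in>carrier UP. \<forall>i j. x \<otimes>\<^bsub>UP\<^esub> cls (\<lambda>N. u N i) [^]\<^bsub>UP\<^esub> ((2::nat) ^ j) =
        cls (\<lambda>N. u N i) [^]\<^bsub>UP\<^esub> ((2::nat) ^ j) \<otimes>\<^bsub>UP\<^esub> x \<longleftrightarrow> f i < j"
      by blast
  qed
  ultimately show ?thesis using is_model_UP by blast
qed

end

subsection \<open>Dividing lines from the patterns\<close>

text \<open>Initial segments \<open>{..<j}\<close> as sets of indices turn membership into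
  order.\<close>

lemma IP_in_imp_OP_in:
  assumes "IP_in M p xs ys" shows "OP_in M p xs ys"
proof -
  obtain a :: "nat \<Rightarrow> 'a list" and b :: "nat set \<Rightarrow> 'a list"
    where "\<And>i. a i \<in> tuples M xs" "\<And>S. b S \<in> tuples M ys"
      "\<And>i S. sat_at M p (xs @ ys) (a i @ b S) \<longleftrightarrow> i \<in> S"
    using assms unfolding IP_in_def by blast
  then show ?thesis
    unfolding OP_in_def by (intro exI[of _ a] exI[of _ "\<lambda>j. b {..<j}"]) simp
qed

lemma prod_tm_snoc: "ts \<noteq> [] \<Longrightarrow> prod_tm (ts @ [t]) = Mul (prod_tm ts) t"
  by (cases ts) simp_all

context group
begin

lemma IP_in_commute:
  assumes "independence_pattern G"
  shows "IP_in G (commute_fm (Var 0) (Var 1)) [0] [1]"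
proof -
  obtain g c where gc: "g \<in> carrier G" "c \<in> carrier G"
    and ex: "\<forall>S::nat set. \<exists>b\<in>carrier G. \<forall>i. conj_by (g [^] i) c \<otimes> b = b \<otimes> conj_by (g [^] i) c \<longleftrightarrow> i \<in> S"
    using assms unfolding independence_pattern_def by blast
  obtain b where b: "\<And>S::nat set. b S \<in> carrier G"
    "\<And>S i. conj_by (g [^] i) c \<otimes> b S = b S \<otimes> conj_by (g [^] i) c \<longleftrightarrow> i \<in> S"
    using ex by metis
  show ?thesis
    unfolding IP_in_def
    by (intro exI[of _ "\<lambda>i. [conj_by (g [^] i) c]"] exI[of _ "\<lambda>S. [b S]"])
      (simp add: gc b tuples_def sat_at_def commute_fm_def)
qed

lemma val_prod_tm_powers:
  assumes "n \<ge> 1" "g \<in> carrier G" "\<And>j. j < n \<Longrightarrow> s j = g [^] (k j :: nat)"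
  shows "val G s (prod_tm (map Var [0..<n])) = g [^] (\<Sum>j<n. k j)"
  using assms(1,3)
proof (induction n rule: nat_induct_at_least)
  case base
  then show ?case by simp
next
  case (Suc n)
  then have "map Var [0..<n] \<noteq> []" by simp
  then have "prod_tm (map Var [0..<Suc n]) = Mul (prod_tm (map Var [0..<n])) (Var n)"
    using prod_tm_snoc[of "map Var [0..<n]"] by simp
  then show ?case
    using Suc assms(2) by (simp add: nat_pow_mult del: upt_Suc)
qed

text \<open>Sums of distinct powers of 2 encode the index tuples, so powers of a single element \<open>g\<close> serve
  as the \<open>n\<close> sequences.\<close>

lemma nIP_in_conj_prod:
  assumes "independence_pattern G" "n \<ge> 1"
  shows "nIP_in G (conj_prod_fm n) (map (\<lambda>i. [i]) [0..<n]) [n, n + 1]"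
proof -
  obtain g c where gc: "g \<in> carrier G" "c \<in> carrier G"
    and ex: "\<forall>S::nat set. \<exists>b\<in>carrier G. \<forall>i. conj_by (g [^] i) c \<otimes> b = b \<otimes> conj_by (g [^] i) c \<longleftrightarrow> i \<in> S"
    using assms(1) unfolding independence_pattern_def by blast
  obtain b where b: "\<And>S::nat set. b S \<in> carrier G"
    "\<And>S i. conj_by (g [^] i) c \<otimes> b S = b S \<otimes> conj_by (g [^] i) c \<longleftrightarrow> i \<in> S"
    using ex by metis
  \<comment> \<open>Including the position j keeps the summands distinct, so the binary digits of
    the sum \<open>h l\<close> recover which entry stands where.\<close>
  define k where "k l j = (2::nat) ^ prod_encode (j, l ! j)" for l j
  define h where "h l = set_encode ((\<lambda>j. prod_encode (j, l ! j)) ` {..<n})" for l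
  have h: "h l = (\<Sum>j<n. k l j)" for l
    unfolding h_def set_encode_def k_def by (subst sum.reindex) (auto simp: inj_on_def)
  have h_inj: "l = l'" if "h l = h l'" "length l = n" "length l' = n" for l l'
  proof (rule nth_equalityI)
    have eq: "(\<lambda>j. prod_encode (j, l ! j)) ` {..<n} = (\<lambda>j. prod_encode (j, l' ! j)) ` {..<n}"
      using that(1) unfolding h_def by (subst (asm) set_encode_eq) auto
    fix i assume "i < length l"
    then have "prod_encode (i, l ! i) \<in> (\<lambda>j. prod_encode (j, l' ! j)) ` {..<n}"
      unfolding eq[symmetric] using that(2) by auto
    then show "l ! i = l' ! i" by auto
  qed (use that in simp)
  define as where "as l = map (\<lambda>j. g [^] k l j) [0..<n]" for l
  define s where "s l y v = (case map_of (zip ([0..<n] @ [n, n + 1]) (as l @ [c, y])) v of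
      Some a \<Rightarrow> a | None \<Rightarrow> \<one>)" for l y v
  have s: "s l y v = (as l @ [c, y]) ! v" if "v < n + 2" for l y v
  proof -
    have len: "length ([0..<n] @ [n, n + 1]) = length (as l @ [c, y])" by (simp add: as_def)
    have "([0..<n] @ [n, n + 1]) ! v = v"
      using that by (auto simp: nth_append less_Suc_eq)
    moreover have "map_of (zip ([0..<n] @ [n, n + 1]) (as l @ [c, y])) (([0..<n] @ [n, n + 1]) ! v) =
        Some ((as l @ [c, y]) ! v)"
      using that by (intro map_of_zip_nth[OF len]) (auto simp: as_def)
    ultimately show ?thesis by (simp add: s_def)
  qed
  have sat: "sat_at G (conj_prod_fm n) ([0..<n] @ [n, n + 1]) (as l @ [c, b T]) \<longleftrightarrow> h l \<in> T" for l T
  proof -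
    have "val G (s l (b T)) (prod_tm (map Var [0..<n])) = g [^] h l"
      unfolding h using assms(2) gc(1) by (rule val_prod_tm_powers) (simp add: s as_def nth_append)
    moreover have "s l (b T) n = c" "s l (b T) (Suc n) = b T"
      by (simp_all add: s as_def nth_append)
    ultimately have "sat G (s l (b T)) (conj_prod_fm n) \<longleftrightarrow> h l \<in> T"
      using b(2)[of "h l" T]
      by (simp add: conj_prod_fm_def commute_fm_def conj_tm_def conj_by_def)
    then show ?thesis
      by (simp only: sat_at_def s_def[abs_def])
  qed
  have concat1: "concat (map (\<lambda>i. [i]) [0..<n]) = [0..<n]"
    by (simp add: concat_map_singleton)
  have concat2: "concat (map (\<lambda>j. [g [^] ((2::nat) ^ prod_encode (j, l ! j))]) [0..<n]) = as l" for l
    by (simp add: as_def k_def concat_map_singleton)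
  show ?thesis
    unfolding nIP_in_def Let_def concat1
  proof (intro exI[of _ "\<lambda>j i. [g [^] ((2::nat) ^ prod_encode (j, i))]"] exI[of _ "\<lambda>S. [c, b (h ` S)]"]
      conjI allI impI)
    show "[g [^] ((2::nat) ^ prod_encode (j, i))] \<in> tuples G (map (\<lambda>i. [i]) [0..<n] ! j)"
      if "j < length (map (\<lambda>i. [i]) [0..<n])" for i j
      using that gc by (simp add: tuples_def)
    show "[c, b (h ` S)] \<in> tuples G [n, n + 1]" for S
      using gc b by (simp add: tuples_def)
    fix S :: "nat list set" and l :: "nat list"
    assume S: "S \<subseteq> {l. length l = length (map (\<lambda>i. [i]) [0..<n])}"
      and l: "length l = length (map (\<lambda>i. [i]) [0..<n])"
    have "h l \<in> h ` S \<longleftrightarrow> l \<in> S"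
      using S l h_inj by auto
    then show "sat_at G (conj_prod_fm n) ([0..<n] @ [n, n + 1])
        (concat (map (\<lambda>j. [g [^] ((2::nat) ^ prod_encode (j, l ! j))])
           [0..<length (map (\<lambda>i. [i]) [0..<n])]) @ [c, b (h ` S)]) \<longleftrightarrow> l \<in> S"
      using sat[of l "h ` S"] concat2 by simp
  qed
qed

section \<open>Increasing chains of centralisers of the powers u^(2^j)\<close>

lemma commute_power_mono:
  assumes "x \<otimes> u [^] ((2::nat) ^ i) = u [^] ((2::nat) ^ i) \<otimes> x" "i \<le> j"
    "x \<in> carrier G" "u \<in> carrier G"
  shows "x \<otimes> u [^] ((2::nat) ^ j) = u [^] ((2::nat) ^ j) \<otimes> x"
proof -
  have "(2::nat) ^ j = 2 ^ i * 2 ^ (j - i)"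
    using assms(2) by (simp flip: power_add)
  then show ?thesis
    using group_commutes_pow[of "u [^] ((2::nat) ^ i)" x "2 ^ (j - i)"] assms by (simp add: nat_pow_pow)
qed

text \<open>A larger centraliser on the right admits more solutions, which gives the inclusions. For
  i < j, the parameter u^(2^j) solves its own formula but not that of u^(2^i): the x with constant
  path i commutes with the former and not with the latter.\<close>

lemma SOP_in_centraliser_le:
  assumes "array_pattern G"
  shows "SOP_in G (centraliser_le_fm 2 0 1) [0] [1]"
proof -
  obtain u :: "nat \<Rightarrow> 'a" where u: "range u \<subseteq> carrier G"
    and ex: "\<And>f. \<exists>x\<in>carrier G. \<forall>i j. x \<otimes> u i [^] ((2::nat) ^ j) = u i [^] ((2::nat) ^ j) \<otimes> x \<longleftrightarrow> f i < j"
    using assms unfolding array_pattern_def by blast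
  have u0: "u 0 \<in> carrier G" using u by blast
  let ?p = "\<lambda>j. u 0 [^] ((2::nat) ^ j)"
  have sol: "solutions G (centraliser_le_fm 2 0 1) [0] [1] [y] =
    {[x] | x. x \<in> carrier G \<and> (\<forall>z\<in>carrier G. z \<otimes> x = x \<otimes> z \<longrightarrow> z \<otimes> y = y \<otimes> z)}" for y
    by (auto simp: solutions_def tuples_def sat_at_def centraliser_le_fm_def commute_fm_def Imp_def
        length_Suc_conv)
  have "solutions G (centraliser_le_fm 2 0 1) [0] [1] [?p i] \<subset>
      solutions G (centraliser_le_fm 2 0 1) [0] [1] [?p j]" if "i < j" for i j
  proof
    show "solutions G (centraliser_le_fm 2 0 1) [0] [1] [?p i] \<subseteq>
      solutions G (centraliser_le_fm 2 0 1) [0] [1] [?p j]"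
      unfolding sol using commute_power_mono[of _ "u 0" i j] u0 that by auto
    obtain x where x: "x \<in> carrier G" "\<And>k. x \<otimes> ?p k = ?p k \<otimes> x \<longleftrightarrow> i < k"
      using ex[of "\<lambda>_. i"] by blast
    have "[?p j] \<notin> solutions G (centraliser_le_fm 2 0 1) [0] [1] [?p i]"
      unfolding sol using x that by auto
    moreover have "[?p j] \<in> solutions G (centraliser_le_fm 2 0 1) [0] [1] [?p j]"
      unfolding sol using u0 by simp
    ultimately show "solutions G (centraliser_le_fm 2 0 1) [0] [1] [?p i] \<noteq>
      solutions G (centraliser_le_fm 2 0 1) [0] [1] [?p j]" by metis
  qed
  then show ?thesis
    unfolding SOP_in_def using u0 by (intro exI[of _ "\<lambda>i. [?p i]"]) (auto simp: tuples_def)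
qed

text \<open>Differences of consecutive members of an increasing chain are disjoint, so rows are
  2-inconsistent. The x attached to f lies in the difference number f i of every row i at
  once.\<close>

lemma TP2_in_centraliser_diff:
  assumes "array_pattern G"
  shows "TP2_in G (centraliser_diff_fm 0 1 2) [0] [1, 2]"
proof -
  obtain u :: "nat \<Rightarrow> 'a" where u: "range u \<subseteq> carrier G"
    and ex: "\<And>f. \<exists>x\<in>carrier G. \<forall>i j. x \<otimes> u i [^] ((2::nat) ^ j) = u i [^] ((2::nat) ^ j) \<otimes> x \<longleftrightarrow> f i < j"
    using assms unfolding array_pattern_def by blast
  have u_closed: "u i \<in> carrier G" for i using u by blast
  define a where "a i j = [u i [^] ((2::nat) ^ j), u i [^] ((2::nat) ^ Suc j)]" for i j
  have sol: "[x] \<in> solutions G (centraliser_diff_fm 0 1 2) [0] [1, 2] (a i j) \<longleftrightarrow> x \<in> carrier G \<and>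
      x \<otimes> u i [^] ((2::nat) ^ Suc j) = u i [^] ((2::nat) ^ Suc j) \<otimes> x \<and>
      x \<otimes> u i [^] ((2::nat) ^ j) \<noteq> u i [^] ((2::nat) ^ j) \<otimes> x" for x i j
    by (auto simp: solutions_def tuples_def sat_at_def centraliser_diff_fm_def commute_fm_def a_def
        simp del: power_Suc)
  have disjoint: False
    if "j < j'" "[x] \<in> solutions G (centraliser_diff_fm 0 1 2) [0] [1, 2] (a i j)"
      "[x] \<in> solutions G (centraliser_diff_fm 0 1 2) [0] [1, 2] (a i j')" for x i j j'
    using that commute_power_mono[of x "u i" "Suc j" j'] u_closed unfolding sol by auto
  show ?thesis
    unfolding TP2_in_def
  proof (intro exI[of _ a] exI[of _ 2] conjI allI impI)
    show "a i j \<in> tuples G [1, 2]" for i j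
      using u_closed by (simp add: a_def tuples_def)
    fix i and J :: "nat set" assume "finite J \<and> card J = 2"
    then obtain j j' where J: "J = {j, j'}" "j < j'"
      by (metis card_2_iff insert_commute linorder_neqE_nat)
    show "\<not> (\<exists>c\<in>tuples G [0]. \<forall>j\<in>J. c \<in> solutions G (centraliser_diff_fm 0 1 2) [0] [1, 2] (a i j))"
    proof
      assume "\<exists>c\<in>tuples G [0]. \<forall>j\<in>J. c \<in> solutions G (centraliser_diff_fm 0 1 2) [0] [1, 2] (a i j)"
      then obtain x where "\<forall>j\<in>J. [x] \<in> solutions G (centraliser_diff_fm 0 1 2) [0] [1, 2] (a i j)"
        by (auto simp: tuples_def length_Suc_conv)
      then show False using disjoint[OF J(2), of x i] by (simp add: J(1))
    qed
  next
    fix f :: "nat \<Rightarrow> nat" and I :: "nat set"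
    obtain x where x: "x \<in> carrier G"
      "\<And>i j. x \<otimes> u i [^] ((2::nat) ^ j) = u i [^] ((2::nat) ^ j) \<otimes> x \<longleftrightarrow> f i < j"
      using ex[of f] by blast
    show "\<exists>c\<in>tuples G [0]. \<forall>i\<in>I. c \<in> solutions G (centraliser_diff_fm 0 1 2) [0] [1, 2] (a i (f i))"
    proof (intro bexI[of _ "[x]"] ballI)
      show "[x] \<in> tuples G [0]" using x by (simp add: tuples_def)
      show "[x] \<in> solutions G (centraliser_diff_fm 0 1 2) [0] [1, 2] (a i (f i))" for i
        unfolding sol x(2) using x(1) by simp
    qed
  qed
qed

end

theorem theorem5p18:
  fixes \<Gamma> :: "('a, 'b) monoid_scheme"
  assumes "group \<Gamma>"
    and "inner_ultrahomogeneous \<Gamma>"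
    and "infinite_exponent \<Gamma>"
  shows "has_IP (Th \<Gamma>) (commute_fm (Var 0) (Var 1)) [0] [1]
       \<and> has_OP (Th \<Gamma>) (commute_fm (Var 0) (Var 1)) [0] [1]
       \<and> (\<forall>n\<ge>1. has_nIP (Th \<Gamma>) (conj_prod_fm n) (map (\<lambda>i. [i]) [0..<n]) [n, n + 1])
       \<and> has_SOP (Th \<Gamma>) (centraliser_le_fm 2 0 1) [0] [1]
       \<and> has_TP2 (Th \<Gamma>) (centraliser_diff_fm 0 1 2) [0] [1, 2]"
proof -
  interpret inner_ultrahomogeneous_group \<Gamma>
    using assms by (simp add: inner_ultrahomogeneous_group_def inner_ultrahomogeneous_group_axioms_def)
  \<comment> \<open>A single model carries both patterns and witnesses all five properties.\<close>
  obtain M :: "(nat \<Rightarrow> nat) monoid"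
    where M: "is_model M (Th \<Gamma>)" "independence_pattern M" "array_pattern M"
    using model_with_patterns[OF assms(3)] by blast
  interpret M: group M using M(1) by (simp add: is_model_def)
  note IP = M.IP_in_commute[OF M(2)]
  show ?thesis
    unfolding has_IP_def has_OP_def has_nIP_def has_SOP_def has_TP2_def
    using M(1) IP IP_in_imp_OP_in[OF IP] M.nIP_in_conj_prod[OF M(2)]
      M.SOP_in_centraliser_le[OF M(3)] M.TP2_in_centraliser_diff[OF M(3)] by blast
qed

end
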